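(* Suppose that $G$ is a connected ribbon graph and that $A,B\subseteq E(G)$ either both define plane-biseparations of $G$, or both define $\mathbb{R}\mathrm{P}^2$-biseparations of $G$. Then $A$ and $B$ are related by toggling join-summands.
   Context: A ribbon graph is a surface with boundary made of vertex discs and edge discs meeting in disjoint segments, each segment on the boundary of exactly one vertex and one edge, each edge containing exactly two segments; considered up to homeomorphism. For $A\subseteq E(G)$, $A^c=E(G)\setminus A$; $G|_A$ consists of edges of $A$ and incident vertices; $G-A$ deletes the edges of $A$ keeping all vertices. Euler genus $\gamma$: twice the genus if orientable, non-orientable genus otherwise, summed over components. Plane (resp. $\mathbb{R}\mathrm{P}^2$) ribbon graph: connected with $\gamma=0$ (resp. $\gamma=1$). $1$-sum: $G=P\oplus Q$ if $P,Q$ are non-trivial connected ribbon subgraphs of connected $G$ with $G=P\cup Q$ and $P\cap Q$ a single vertex $v$. It is a join $G=P\vee Q$ if moreover there is an arc on the boundary of $v$ met by all edges of $P$ incident to $v$ and by no edges of $Q$. Sequences $H_1\oplus\cdots\oplus H_l$, $H_1\vee\cdots\vee H_l$ are read left-associatively: $(\cdots(H_1\oplus H_2)\oplus\cdots)\oplus H_l$. $A$ defines a biseparation of connected $G$ if $A\in\{\emptyset,E(G)\}$, or $G$ can be written as a sequence of $1$-sums whose summands are the components of $G|_A$ and $G|_{A^c}$, each $1$-sum involving a component of $G|_A$ and one of $G|_{A^c}$. Plane-biseparation: a biseparation with every component of $G|_A$ and $G-A$ plane. $\mathbb{R}\mathrm{P}^2$-biseparation: a biseparation with exactly one component of $G|_A$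 or $G-A$ being $\mathbb{R}\mathrm{P}^2$ and all others plane. Toggling: if $G=H_1\vee\cdots\vee H_r$ ($r\ge1$) and $A\subseteq E(G)$, then $A\,\Delta\,E(H_i)$ is obtained from $A$ by toggling a join-summand. Sets $A,B$ are related by toggling join-summands if there is a sequence $A=A_1,\dots,A_n=B$ with each $A_{i+1}$ obtained from $A_i$ by toggling a join-summand. *)

theory Defs
  imports Complex_Main
begin

text \<open>
  A ribbon graph is encoded by an arrow presentation.  For a vertex disc \<open>v\<close>, the list
  \<open>rot G v\<close> records the segments met when going once round the boundary of \<open>v\<close>, in a
  chosen sense and from a chosen starting point.  A segment carries the edge disc it belongs
  to and a flag: orient the boundary circle of the edge disc (once and for all for each edge);
  the flag is \<open>True\<close> iff on that segment this orientation agrees with the chosen sense at \<open>v\<close>.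
  Every arrow presentation arises from a ribbon graph, which it determines up to homeomorphism.
\<close>

record ('v, 'e) ribbon_graph =
  verts :: "'v set"
  edges :: "'e set"
  rot :: "'v \<Rightarrow> ('e \<times> bool) list"

type_synonym 'v segment = "'v \<times> nat"

definition segments :: "('v, 'e) ribbon_graph \<Rightarrow> 'v segment set" where
  "segments G = {(v, i). v \<in> verts G \<and> i < length (rot G v)}"

definition seg_edge :: "('v, 'e) ribbon_graph \<Rightarrow> 'v segment \<Rightarrow> 'e" where
  "seg_edge G s = fst (rot G (fst s) ! snd s)"

definition seg_dir :: "('v, 'e) ribbon_graph \<Rightarrow> 'v segment \<Rightarrow> bool" where
  "seg_dir G s = snd (rot G (fst s) ! snd s)"

text \<open>The clause on \<open>v \<notin> verts G\<close> only fixes the irrelevant values of \<open>rot G\<close>, so that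
  equality of records is equality of ribbon subgraphs.\<close>

definition ribbon_graph :: "('v, 'e) ribbon_graph \<Rightarrow> bool" where
  "ribbon_graph G \<longleftrightarrow>
     finite (verts G) \<and> finite (edges G) \<and>
     (\<forall>s \<in> segments G. seg_edge G s \<in> edges G) \<and>
     (\<forall>e \<in> edges G. card {s \<in> segments G. seg_edge G s = e} = 2) \<and>
     (\<forall>v. v \<notin> verts G \<longrightarrow> rot G v = [])"

definition incident :: "('v, 'e) ribbon_graph \<Rightarrow> 'e \<Rightarrow> 'v \<Rightarrow> bool" where
  "incident G e v \<longleftrightarrow> (\<exists>s \<in> segments G. fst s = v \<and> seg_edge G s = e)"


subsection \<open>Ribbon subgraphs\<close>

definition restrict :: "('v, 'e) ribbon_graph \<Rightarrow> 'v set \<Rightarrow> 'e set \<Rightarrow> ('v, 'e) ribbon_graph" where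
  "restrict G W F =
     \<lparr>verts = W, edges = F,
      rot = (\<lambda>v. if v \<in> W then filter (\<lambda>x. fst x \<in> F) (rot G v) else [])\<rparr>"

definition ribbon_subgraph :: "('v, 'e) ribbon_graph \<Rightarrow> ('v, 'e) ribbon_graph \<Rightarrow> bool" where
  "ribbon_subgraph H G \<longleftrightarrow>
     ribbon_graph H \<and> verts H \<subseteq> verts G \<and> edges H \<subseteq> edges G \<and>
     H = restrict G (verts H) (edges H)"

text \<open>\<open>edge_restriction G A\<close> is $G|_A$ and \<open>delete_edges G A\<close> is $G - A$.\<close>

definition edge_restriction :: "('v, 'e) ribbon_graph \<Rightarrow> 'e set \<Rightarrow> ('v, 'e) ribbon_graph" where
  "edge_restriction G A = restrict G {v \<in> verts G. \<exists>e \<in> A. incident G e v} A"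

definition delete_edges :: "('v, 'e) ribbon_graph \<Rightarrow> 'e set \<Rightarrow> ('v, 'e) ribbon_graph" where
  "delete_edges G A = restrict G (verts G) (edges G - A)"

definition adjacency :: "('v, 'e) ribbon_graph \<Rightarrow> ('v \<times> 'v) set" where
  "adjacency G = {(u, v). \<exists>e \<in> edges G. incident G e u \<and> incident G e v}"

definition connected_rg :: "('v, 'e) ribbon_graph \<Rightarrow> bool" where
  "connected_rg G \<longleftrightarrow>
     verts G \<noteq> {} \<and> (\<forall>u \<in> verts G. \<forall>v \<in> verts G. (u, v) \<in> (adjacency G)\<^sup>*)"

definition component_of :: "('v, 'e) ribbon_graph \<Rightarrow> 'v \<Rightarrow> ('v, 'e) ribbon_graph" where
  "component_of G u =
     (let W = {w \<in> verts G. (u, w) \<in> (adjacency G)\<^sup>*}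
      in restrict G W {e \<in> edges G. \<exists>w \<in> W. incident G e w})"

definition components_rg :: "('v, 'e) ribbon_graph \<Rightarrow> ('v, 'e) ribbon_graph set" where
  "components_rg G = component_of G ` verts G"


subsection \<open>Boundary components and genus\<close>

text \<open>
  A corner is an end of a segment: \<open>(s, False)\<close> and \<open>(s, True)\<close> are the first and the last
  point of \<open>s\<close> in the chosen sense at its vertex.  The boundary of the surface consists of the
  arcs of vertex boundaries between consecutive segments, of the sides of the edge discs (an
  oriented edge boundary runs from the head of one segment to the tail of the other), and of
  one full circle for every isolated vertex.
\<close>

definition corners :: "('v, 'e) ribbon_graph \<Rightarrow> ('v segment \<times> bool) set" where
  "corners G = segments G \<times> UNIV"

definition vertex_arcs ::
    "('v, 'e) ribbon_graph \<Rightarrow> (('v segment \<times> bool) \<times> ('v segment \<times> bool)) set" where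
  "vertex_arcs G =
     {(((v, i), True), ((v, Suc i mod length (rot G v)), False)) | v i. (v, i) \<in> segments G}"

definition edge_sides ::
    "('v, 'e) ribbon_graph \<Rightarrow> (('v segment \<times> bool) \<times> ('v segment \<times> bool)) set" where
  "edge_sides G =
     {((s, seg_dir G s), (t, \<not> seg_dir G t)) | s t.
        s \<in> segments G \<and> t \<in> segments G \<and> s \<noteq> t \<and> seg_edge G s = seg_edge G t}"

definition boundary_rel ::
    "('v, 'e) ribbon_graph \<Rightarrow> (('v segment \<times> bool) \<times> ('v segment \<times> bool)) set" where
  "boundary_rel G =
     (vertex_arcs G \<union> (vertex_arcs G)\<inverse> \<union> edge_sides G \<union> (edge_sides G)\<inverse>)\<^sup>*"

definition num_boundary_components :: "('v, 'e) ribbon_graph \<Rightarrow> nat" where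
  "num_boundary_components G =
     card (corners G // boundary_rel G) + card {v \<in> verts G. rot G v = []}"

text \<open>\<open>c\<close> marks the vertex discs whose orientation is reversed.\<close>

definition orientable :: "('v, 'e) ribbon_graph \<Rightarrow> bool" where
  "orientable G \<longleftrightarrow>
     (\<exists>c :: 'v \<Rightarrow> bool. \<forall>s \<in> segments G. \<forall>t \<in> segments G.
        s \<noteq> t \<and> seg_edge G s = seg_edge G t \<longrightarrow>
        (seg_dir G s = seg_dir G t \<longleftrightarrow> c (fst s) = c (fst t)))"

text \<open>The Euler characteristic of the closed surface obtained by gluing a disc to each
  boundary component; the surface itself has Euler characteristic $|V| - |E|$.\<close>

definition closed_euler_char :: "('v, 'e) ribbon_graph \<Rightarrow> real" where
  "closed_euler_char G =
     real (card (verts G)) - real (card (edges G)) + real (num_boundary_components G)"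

text \<open>For connected \<open>G\<close>: a closed surface of genus $g$ has Euler characteristic $2 - 2g$
  if it is orientable and $2 - g$ otherwise.\<close>

definition genus :: "('v, 'e) ribbon_graph \<Rightarrow> real" where
  "genus G =
     (if orientable G then (2 - closed_euler_char G) / 2 else 2 - closed_euler_char G)"

definition euler_genus :: "('v, 'e) ribbon_graph \<Rightarrow> real" where
  "euler_genus G =
     (\<Sum>H \<in> components_rg G. if orientable H then 2 * genus H else genus H)"

definition plane_rg :: "('v, 'e) ribbon_graph \<Rightarrow> bool" where
  "plane_rg G \<longleftrightarrow> connected_rg G \<and> euler_genus G = 0"

definition rp2_rg :: "('v, 'e) ribbon_graph \<Rightarrow> bool" where
  "rp2_rg G \<longleftrightarrow> connected_rg G \<and> euler_genus G = 1"


subsection \<open>1-sums and joins\<close>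

definition one_sum_at ::
    "('v, 'e) ribbon_graph \<Rightarrow> ('v, 'e) ribbon_graph \<Rightarrow> ('v, 'e) ribbon_graph \<Rightarrow> 'v \<Rightarrow> bool" where
  "one_sum_at G P Q v \<longleftrightarrow>
     ribbon_graph G \<and> connected_rg G \<and>
     ribbon_subgraph P G \<and> connected_rg P \<and> edges P \<noteq> {} \<and>
     ribbon_subgraph Q G \<and> connected_rg Q \<and> edges Q \<noteq> {} \<and>
     verts P \<union> verts Q = verts G \<and> edges P \<union> edges Q = edges G \<and>
     verts P \<inter> verts Q = {v} \<and> edges P \<inter> edges Q = {}"

definition one_sum ::
    "('v, 'e) ribbon_graph \<Rightarrow> ('v, 'e) ribbon_graph \<Rightarrow> ('v, 'e) ribbon_graph \<Rightarrow> bool" where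
  "one_sum G P Q \<longleftrightarrow> (\<exists>v. one_sum_at G P Q v)"

text \<open>In a join, all segments at \<open>v\<close> of edges of \<open>P\<close> (both of them for a loop) lie on the arc.\<close>

definition join_rg ::
    "('v, 'e) ribbon_graph \<Rightarrow> ('v, 'e) ribbon_graph \<Rightarrow> ('v, 'e) ribbon_graph \<Rightarrow> bool" where
  "join_rg G P Q \<longleftrightarrow>
     (\<exists>v. one_sum_at G P Q v \<and>
        (\<exists>n ps qs. rotate n (rot G v) = ps @ qs \<and>
           fst ` set ps \<subseteq> edges P \<and> fst ` set qs \<subseteq> edges Q))"

inductive one_sum_seq :: "('v, 'e) ribbon_graph \<Rightarrow> ('v, 'e) ribbon_graph list \<Rightarrow> bool" where
  single: "one_sum_seq G [G]"
| snoc: "one_sum_seq K Hs \<Longrightarrow> one_sum G K H \<Longrightarrow> one_sum_seq G (Hs @ [H])"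

inductive join_seq :: "('v, 'e) ribbon_graph \<Rightarrow> ('v, 'e) ribbon_graph list \<Rightarrow> bool" where
  single: "join_seq G [G]"
| snoc: "join_seq K Hs \<Longrightarrow> join_rg G K H \<Longrightarrow> join_seq G (Hs @ [H])"


subsection \<open>Biseparations\<close>

text \<open>The $i$-th summand is attached, at the vertex of the corresponding 1-sum, to an earlier
  summand of the opposite kind.\<close>

definition biseparation :: "('v, 'e) ribbon_graph \<Rightarrow> 'e set \<Rightarrow> bool" where
  "biseparation G A \<longleftrightarrow>
     A \<subseteq> edges G \<and>
     (A = {} \<or> A = edges G \<or>
      (let CA = components_rg (edge_restriction G A);
           CB = components_rg (edge_restriction G (edges G - A))
       in \<exists>Hs. distinct Hs \<and> set Hs = CA \<union> CB \<and> one_sum_seq G Hs \<and>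
            (\<forall>i < length Hs. 0 < i \<longrightarrow>
               (\<exists>j < i. verts (Hs ! j) \<inter> verts (Hs ! i) \<noteq> {} \<and>
                  (Hs ! j \<in> CA \<and> Hs ! i \<in> CB \<or> Hs ! j \<in> CB \<and> Hs ! i \<in> CA)))))"

text \<open>A ribbon graph that is a component of both $G|_A$ and $G - A$ would have no edges, but
  every component of $G|_A$ has an edge; hence the union below is disjoint.\<close>

definition separated_components ::
    "('v, 'e) ribbon_graph \<Rightarrow> 'e set \<Rightarrow> ('v, 'e) ribbon_graph set" where
  "separated_components G A =
     components_rg (edge_restriction G A) \<union> components_rg (delete_edges G A)"

definition plane_biseparation :: "('v, 'e) ribbon_graph \<Rightarrow> 'e set \<Rightarrow> bool" where
  "plane_biseparation G A \<longleftrightarrow>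
     biseparation G A \<and> (\<forall>H \<in> separated_components G A. plane_rg H)"

definition rp2_biseparation :: "('v, 'e) ribbon_graph \<Rightarrow> 'e set \<Rightarrow> bool" where
  "rp2_biseparation G A \<longleftrightarrow>
     biseparation G A \<and>
     (\<exists>H \<in> separated_components G A. rp2_rg H \<and>
        (\<forall>H' \<in> separated_components G A - {H}. plane_rg H'))"


subsection \<open>Toggling join-summands\<close>

definition toggle_step :: "('v, 'e) ribbon_graph \<Rightarrow> 'e set \<Rightarrow> 'e set \<Rightarrow> bool" where
  "toggle_step G A B \<longleftrightarrow>
     A \<subseteq> edges G \<and>
     (\<exists>Hs. join_seq G Hs \<and> (\<exists>H \<in> set Hs. B = sym_diff A (edges H)))"

definition toggle_related :: "('v, 'e) ribbon_graph \<Rightarrow> 'e set \<Rightarrow> 'e set \<Rightarrow> bool" where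
  "toggle_related G = (toggle_step G)\<^sup>*\<^sup>*"

end

(*
  Two ideas. First, edges sharing a vertex other than u are in the same bridge at u. If C is a
  union of bridges at every vertex, and at no vertex do bridges inside C interlace with bridges
  outside C, then cutting the graph along joins (an innermost arc of the rotation at a suitable
  vertex is always a union of bridges) lets one toggle C. Second, the symmetric difference of A
  and B, after possibly complementing either of them, is such a set C. Every cycle lies on one
  side of a biseparation, inside one component. Interlaced bridges at u give two cycles that meet
  only at u and cross there; by mod 2 homology this is impossible in a plane component, and in a
  projective plane component it forces both cycles to be one-sided. A plane component has no
  one-sided cycle, so the one-sided cycles all lie on the side of A (and of B) that contains the
  projective plane component, and all other interlaced pairs are separated by both A and B.
*)
theory Submission
  imports Defs "HOL-Library.Sublist"
begin

text \<open>\<open>A\<close> and \<open>B\<close> are never compared component by component. What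
  passes from one to the other is the parity of the number of twisted edges on a cycle: it is read
  off from \<open>G\<close> alone and is the same in every ribbon subgraph that contains the cycle.
  Homology enters only as a count. A connected ribbon graph with V vertices, E > 0 edges and F
  boundary components has at most 2^(E-V+1) mod 2 cycles and at least 2^(F-1) boundaries, and every
  boundary is a cycle. Since V-E+F is 2 minus the Euler genus, the boundaries are all the cycles in
  the plane case and have index at most 2 in the projective plane case. Regions of the surface are
  sets of corners, so a crossing at \<open>u\<close> is detected by counting how often a walk round
  \<open>u\<close> passes an edge of the boundary of a region. The obstacle to finding a join is a
  pair of segments in one bridge with a segment of the other colour between them, where the colour
  is membership in C. A shortest such pair traps the bridges of that other colour between its ends,
  and among them no further obstruction is left.\<close>

section \<open>Degrees of edge sets and ribbon subgraphs\<close>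

definition deg :: "('v, 'e) ribbon_graph \<Rightarrow> 'e set \<Rightarrow> 'v \<Rightarrow> nat" where
  "deg G Z v = length (filter (\<lambda>x. fst x \<in> Z) (rot G v))"

text \<open>Since \<open>deg\<close> counts both segments of a loop, a set of edges with this
  property is exactly a mod 2 cycle of the graph.\<close>

definition even_set :: "('v, 'e) ribbon_graph \<Rightarrow> 'e set \<Rightarrow> bool" where
  "even_set G Z \<longleftrightarrow> (\<forall>v. even (deg G Z v))"

text \<open>The reflexive transitive closure of \<open>off G u\<close> puts two edges in relation iff they lie in
  the same bridge at \<open>u\<close>.\<close>

definition off :: "('v, 'e) ribbon_graph \<Rightarrow> 'v \<Rightarrow> ('e \<times> 'e) set" where
  "off G u = {(e, f). \<exists>w. w \<noteq> u \<and> incident G e w \<and> incident G f w}"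

lemma deg_card: "deg G Z v = card {i. i < length (rot G v) \<and> fst (rot G v ! i) \<in> Z}"
  by (simp add: deg_def length_filter_conv_card)

lemma deg_Un: "Z \<inter> Z' = {} \<Longrightarrow> deg G (Z \<union> Z') v = deg G Z v + deg G Z' v"
proof -
  have "Z \<inter> Z' = {} \<Longrightarrow> length (filter (\<lambda>x. fst x \<in> Z \<union> Z') xs) =
      length (filter (\<lambda>x. fst x \<in> Z) xs) + length (filter (\<lambda>x. fst x \<in> Z') xs)" for xs
    by (induction xs) auto
  then show "Z \<inter> Z' = {} \<Longrightarrow> deg G (Z \<union> Z') v = deg G Z v + deg G Z' v"
    by (simp add: deg_def)
qed

lemma deg_mono: "Z \<subseteq> Z' \<Longrightarrow> deg G Z v \<le> deg G Z' v"
  using deg_Un[of Z "Z' - Z" G v] by (simp add: Un_absorb1)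

lemma deg_insert: "e \<notin> Z \<Longrightarrow> deg G (insert e Z) v = deg G {e} v + deg G Z v"
  using deg_Un[of "{e}" Z G v] by simp

lemma deg_sym_diff: "even (deg G (sym_diff Z Z') v) \<longleftrightarrow> even (deg G Z v + deg G Z' v)"
proof -
  have "deg G Y v = deg G (Y - Y') v + deg G (Y \<inter> Y') v" for Y Y'
    using deg_Un[of "Y - Y'" "Y \<inter> Y'" G v] by (simp add: Un_Diff_Int Int_Diff disjoint_iff)
  note this[of Z Z'] this[of Z' Z]
  moreover have "deg G (sym_diff Z Z') v = deg G (Z - Z') v + deg G (Z' - Z) v"
    by (rule deg_Un) auto
  ultimately show ?thesis by (auto simp: Int_commute)
qed

lemma deg_eq_0_iff: "deg G Z v = 0 \<longleftrightarrow> (\<forall>x \<in> set (rot G v). fst x \<notin> Z)"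
  by (simp add: deg_def filter_empty_conv)

lemma deg_empty [simp]: "deg G {} v = 0"
  by (simp add: deg_def)

lemma incident_iff: "incident G e v \<longleftrightarrow> v \<in> verts G \<and> e \<in> fst ` set (rot G v)"
  by (force simp: incident_def segments_def seg_edge_def in_set_conv_nth image_iff)

lemma incident_deg: "incident G e v \<longleftrightarrow> v \<in> verts G \<and> deg G {e} v > 0"
  using deg_eq_0_iff[of G "{e}" v] by (auto simp: incident_iff)

lemma card_segments_edge_set:
  assumes "finite (verts G)"
  shows "card {s \<in> segments G. seg_edge G s \<in> Z} = (\<Sum>v \<in> verts G. deg G Z v)"
proof -
  have "{s \<in> segments G. seg_edge G s \<in> Z} =
      (SIGMA v:verts G. {i. i < length (rot G v) \<and> fst (rot G v ! i) \<in> Z})"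
    by (auto simp: segments_def seg_edge_def)
  then show ?thesis using assms by (simp add: deg_card)
qed

lemma finite_segments: "finite (verts G) \<Longrightarrow> finite (segments G)"
proof -
  have "segments G = (SIGMA v:verts G. {..<length (rot G v)})"
    by (auto simp: segments_def)
  then show "finite (verts G) \<Longrightarrow> finite (segments G)" by simp
qed

text \<open>Replaces sets of segments by filtered rotations. Ribbon subgraphs are formed by
  filtering rotations too, whereas the positions of segments shift under restriction.\<close>

lemma ribbon_graph_iff:
  "ribbon_graph G \<longleftrightarrow> finite (verts G) \<and> finite (edges G) \<and>
     (\<forall>v. fst ` set (rot G v) \<subseteq> edges G) \<and>
     (\<forall>e \<in> edges G. (\<Sum>v \<in> verts G. deg G {e} v) = 2) \<and>
     (\<forall>v. v \<notin> verts G \<longrightarrow> rot G v = [])"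
proof -
  have 1: "(\<forall>s \<in> segments G. seg_edge G s \<in> edges G) \<longleftrightarrow> (\<forall>v. fst ` set (rot G v) \<subseteq> edges G)"
    if "\<forall>v. v \<notin> verts G \<longrightarrow> rot G v = []"
  proof -
    have "v \<in> verts G" if "i < length (rot G v)" for v i
      using that \<open>\<forall>v. v \<notin> verts G \<longrightarrow> rot G v = []\<close> by (cases "v \<in> verts G") auto
    then show ?thesis
      by (fastforce simp: segments_def seg_edge_def in_set_conv_nth image_subset_iff)
  qed
  have 2: "card {s \<in> segments G. seg_edge G s = e} = (\<Sum>v \<in> verts G. deg G {e} v)"
    if "finite (verts G)" for e
    using card_segments_edge_set[OF that, of "{e}"] by simp
  show ?thesis unfolding ribbon_graph_def using 1 2 by auto
qed

context
  fixes G :: "('v, 'e) ribbon_graph"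
  assumes rg: "ribbon_graph G"
begin

lemma finite_verts: "finite (verts G)" and finite_edges: "finite (edges G)"
  and rot_edges: "x \<in> set (rot G v) \<Longrightarrow> fst x \<in> edges G"
  and deg_edge: "e \<in> edges G \<Longrightarrow> (\<Sum>v \<in> verts G. deg G {e} v) = 2"
  and rot_outside: "v \<notin> verts G \<Longrightarrow> rot G v = []"
  using rg unfolding ribbon_graph_iff by auto

lemma deg_outside: "v \<notin> verts G \<Longrightarrow> deg G Z v = 0"
  by (simp add: deg_def rot_outside)

lemma rot_vert: "x \<in> set (rot G v) \<Longrightarrow> v \<in> verts G"
  using rot_outside by (metis empty_iff empty_set)

lemma incident_rot: "incident G e v \<longleftrightarrow> e \<in> fst ` set (rot G v)"
  using rot_vert by (auto simp: incident_iff)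

lemma incident_edges: "incident G e v \<Longrightarrow> e \<in> edges G"
  using rot_edges by (auto simp: incident_rot)

lemma deg_Int_edges: "deg G (Z \<inter> edges G) v = deg G Z v"
  unfolding deg_def using rot_edges by (metis (mono_tags, lifting) Int_iff filter_cong)

lemma handshake: "Z \<subseteq> edges G \<Longrightarrow> (\<Sum>v \<in> verts G. deg G Z v) = 2 * card Z"
proof -
  assume "Z \<subseteq> edges G"
  then have "finite Z" using finite_edges finite_subset by blast
  then show ?thesis using \<open>Z \<subseteq> edges G\<close>
  proof (induction Z rule: finite_induct)
    case (insert e Z)
    then show ?case
      by (simp add: deg_insert[OF insert.hyps(2)] sum.distrib deg_edge)
  qed simp
qed

text \<open>By the handshake identity the degrees have an even sum, so the parity at the one vertex
  left out is forced. This settles the common vertex of a 1-sum and the vertex at which two cycles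
  cross.\<close>

lemma even_set_except_vertex:
  assumes "\<And>v. v \<in> verts G \<Longrightarrow> v \<noteq> x \<Longrightarrow> even (deg G Z v)"
  shows "even_set G Z"
proof -
  have "even (deg G Z x)"
  proof (cases "x \<in> verts G")
    case True
    have "even (\<Sum>v \<in> verts G. deg G Z v)"
      using handshake[of "Z \<inter> edges G"] by (simp add: deg_Int_edges)
    moreover have "(\<Sum>v \<in> verts G. deg G Z v) = deg G Z x + (\<Sum>v \<in> verts G - {x}. deg G Z v)"
      using True finite_verts by (simp add: sum.remove)
    moreover have "even (\<Sum>v \<in> verts G - {x}. deg G Z v)"
      using assms by (intro dvd_sum) auto
    ultimately show ?thesis by simp
  qed (simp add: deg_outside)
  then show ?thesis
    unfolding even_set_def using assms deg_outside by (metis dvd_0_right)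
qed

lemma edge_incident: "e \<in> edges G \<Longrightarrow> \<exists>v. incident G e v"
proof (rule ccontr)
  assume e: "e \<in> edges G" and "\<nexists>v. incident G e v"
  then have "(\<Sum>v \<in> verts G. deg G {e} v) = 0" by (simp add: incident_deg)
  then show False using deg_edge[OF e] by simp
qed

lemma edge_two_ends:
  assumes "incident G e u" "incident G e v" "u \<noteq> v"
  shows "deg G {e} u = 1 \<and> deg G {e} v = 1 \<and> (\<forall>w. w \<noteq> u \<and> w \<noteq> v \<longrightarrow> deg G {e} w = 0)"
proof -
  have uv: "u \<in> verts G" "v \<in> verts G" "deg G {e} u > 0" "deg G {e} v > 0"
    using assms by (auto simp: incident_deg)
  have "(\<Sum>v \<in> verts G. deg G {e} v) = 2"
    using deg_edge incident_edges assms by blast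
  then have s: "deg G {e} u + (deg G {e} v + (\<Sum>v \<in> verts G - {u} - {v}. deg G {e} v)) = 2"
    using uv assms(3) finite_verts sum.remove[of "verts G" u "deg G {e}"]
      sum.remove[of "verts G - {u}" v "deg G {e}"] by simp
  then have "deg G {e} u = 1 \<and> deg G {e} v = 1" using uv by linarith
  moreover have "(\<Sum>v \<in> verts G - {u} - {v}. deg G {e} v) = 0" using s uv by linarith
  then have "\<forall>w \<in> verts G - {u} - {v}. deg G {e} w = 0" using finite_verts by simp
  ultimately show ?thesis using deg_outside by blast
qed

lemma deg_restrict: "deg (restrict G W F) Z v = (if v \<in> W then deg G (Z \<inter> F) v else 0)"
  by (simp add: deg_def restrict_def conj_commute)

lemma incident_restrict:
  "W \<subseteq> verts G \<Longrightarrow> incident (restrict G W F) e v \<longleftrightarrow> v \<in> W \<and> e \<in> F \<and> incident G e v"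
  by (force simp: incident_iff restrict_def image_iff)

lemma ribbon_graph_restrict:
  assumes "W \<subseteq> verts G" "F \<subseteq> edges G"
    and "\<And>e v. e \<in> F \<Longrightarrow> incident G e v \<Longrightarrow> v \<in> W"
  shows "ribbon_graph (restrict G W F)"
proof -
  have "(\<Sum>v \<in> W. deg (restrict G W F) {e} v) = 2" if "e \<in> F" for e
  proof -
    have "(\<Sum>v \<in> W. deg (restrict G W F) {e} v) = (\<Sum>v \<in> W. deg G {e} v)"
      using that by (intro sum.cong) (auto simp: deg_restrict)
    also have "\<dots> = (\<Sum>v \<in> verts G. deg G {e} v)"
      using assms that finite_verts
      by (intro sum.mono_neutral_left) (auto simp: incident_deg, metis gr0I)
    finally show ?thesis using that assms deg_edge by auto
  qed
  then show ?thesis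
    unfolding ribbon_graph_iff using assms finite_verts finite_edges
    by (auto simp: restrict_def intro: finite_subset)
qed

lemma restrict_self: "restrict G (verts G) (edges G) = G"
proof -
  have "filter (\<lambda>x. fst x \<in> edges G) (rot G v) = rot G v" for v
    using rot_edges by (simp add: filter_id_conv)
  then have "rot (restrict G (verts G) (edges G)) = rot G"
    using rot_outside by (auto simp: restrict_def)
  then show ?thesis by (simp add: restrict_def)
qed

text \<open>\<open>H\<close> is a ribbon graph, so it retains two segments of \<open>e\<close>. As
  \<open>e\<close> has only two segments in \<open>G\<close>, none is left for a vertex outside
  \<open>H\<close>.\<close>

lemma subgraph_incident:
  assumes "ribbon_subgraph H G" "e \<in> edges H"
  shows "incident G e v \<longleftrightarrow> incident H e v"
proof -
  let ?W = "verts H" and ?F = "edges H"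
  have H: "ribbon_graph H" "?W \<subseteq> verts G" "?F \<subseteq> edges G" "H = restrict G ?W ?F"
    using assms by (auto simp: ribbon_subgraph_def)
  have d: "deg H {e} v = (if v \<in> ?W then deg G {e} v else 0)" for v
    using assms(2) by (subst H(4)) (simp add: deg_restrict)
  have "(\<Sum>v \<in> ?W. deg H {e} v) = 2"
    using H(1) assms(2) by (simp add: ribbon_graph_iff)
  then have "(\<Sum>v \<in> ?W. deg G {e} v) = 2" by (simp add: d)
  moreover have "(\<Sum>v \<in> verts G. deg G {e} v) = (\<Sum>v \<in> verts G - ?W. deg G {e} v) + (\<Sum>v \<in> ?W. deg G {e} v)"
    by (rule sum.subset_diff) (use H finite_verts in auto)
  ultimately have "(\<Sum>v \<in> verts G - ?W. deg G {e} v) = 0"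
    using deg_edge assms(2) H(3) by auto
  then have "\<forall>v \<in> verts G - ?W. deg G {e} v = 0" using finite_verts by simp
  then show ?thesis
    using H(2) by (auto simp: incident_deg d)
qed

lemma sym_off: "(e, f) \<in> (off G u)\<^sup>* \<Longrightarrow> (f, e) \<in> (off G u)\<^sup>*"
proof -
  have "sym (off G u)" by (auto simp: off_def sym_def)
  then show "(e, f) \<in> (off G u)\<^sup>* \<Longrightarrow> (f, e) \<in> (off G u)\<^sup>*"
    using sym_rtrancl symD by metis
qed

end

section \<open>Closed intervals in a two-coloured noncrossing relation\<close>

text \<open>Positions are segments round a vertex, \<open>R\<close> is lying in the same bridge,
  \<open>col\<close> is membership in the set to be toggled. Take a shortest related pair
  \<open>i\<close>, \<open>j\<close> that encloses a position \<open>k\<close> of the other colour.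
  A link from a position of colour \<open>col k\<close> between them to the outside would cross this
  pair, so it cannot exist; by minimality no link inside encloses both colours. Hence a maximal
  one-coloured run around \<open>k\<close> between \<open>i\<close> and \<open>j\<close> is closed
  under \<open>R\<close>.\<close>

lemma closed_interval:
  fixes R :: "nat \<Rightarrow> nat \<Rightarrow> bool" and col :: "nat \<Rightarrow> bool"
  assumes sym: "\<And>i j. R i j \<Longrightarrow> R j i"
    and col: "\<And>i j. i < n \<Longrightarrow> j < n \<Longrightarrow> R i j \<Longrightarrow> col i = col j"
    and noncrossing: "\<And>a b c d. a < b \<Longrightarrow> b < c \<Longrightarrow> c < d \<Longrightarrow> d < n \<Longrightarrow> R a c \<Longrightarrow> R b d \<Longrightarrow> col a = col b"
    and two: "\<exists>i<n. col i" "\<exists>i<n. \<not> col i"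
  shows "\<exists>p q. p < q \<and> q \<le> n \<and> (\<exists>y<n. y \<notin> {p..<q}) \<and>
    (\<forall>i\<in>{p..<q}. \<forall>j<n. R i j \<longrightarrow> j \<in> {p..<q})"
proof -
  define bad where "bad i j \<longleftrightarrow> i < j \<and> j < n \<and> R i j \<and> (\<exists>k. i < k \<and> k < j \<and> col k \<noteq> col i)" for i j
  have "\<exists>lo hi k. lo \<le> k \<and> k < hi \<and> hi \<le> n \<and>
      (\<forall>s\<in>{lo..<hi}. \<forall>m<n. col s = col k \<longrightarrow> R s m \<longrightarrow>
         m \<in> {lo..<hi} \<and> \<not> bad s m \<and> \<not> bad m s)"
  proof (cases "\<exists>i j. bad i j")
    case True
    then obtain i j where bad: "bad i j" and least: "\<And>i' j'. bad i' j' \<Longrightarrow> j - i \<le> j' - i'"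
      using ex_has_least_nat[of "\<lambda>x. bad (fst x) (snd x)" _ "\<lambda>x. snd x - fst x"]
      by (metis fst_conv snd_conv)
    then obtain k where k: "i < k" "k < j" "col k \<noteq> col i" "j < n" "R i j"
      unfolding bad_def by blast
    have in_region: "m \<in> {Suc i..<j}" if s: "s \<in> {Suc i..<j}" "m < n" "col s = col k" "R s m" for s m
    proof (rule ccontr)
      assume "m \<notin> {Suc i..<j}"
      moreover have "col m = col k" using col[of s m] s k by auto
      then have "m \<noteq> i" "m \<noteq> j" using k col[of i j] by auto
      ultimately consider "m < i" | "j < m" by force
      then show False
      proof cases
        case 1
        then show False using noncrossing[of m i s j] s sym k \<open>col m = col k\<close> by auto
      next
        case 2
        then show False using noncrossing[of i s j m] s k by auto
      qed
    qed
    have "\<not> bad s m \<and> \<not> bad m s" if "s \<in> {Suc i..<j}" "m \<in> {Suc i..<j}" for s m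
      using least[of s m] least[of m s] that by auto
    then have "\<forall>s\<in>{Suc i..<j}. \<forall>m<n. col s = col k \<longrightarrow> R s m \<longrightarrow>
         m \<in> {Suc i..<j} \<and> \<not> bad s m \<and> \<not> bad m s"
      using in_region by blast
    moreover have "Suc i \<le> k" "j \<le> n" using k by auto
    ultimately show ?thesis using k(2) by blast
  next
    case False
    \<comment> \<open>Without a bad pair the region is the whole range, and \<open>k\<close> may be
      any position, here \<open>0\<close>.\<close>
    then show ?thesis using two by (intro exI[of _ 0] exI[of _ n] exI[of _ 0]) auto
  qed
  then obtain lo hi k where k: "lo \<le> k" "k < hi" "hi \<le> n"
    and region: "\<And>s m. s \<in> {lo..<hi} \<Longrightarrow> m < n \<Longrightarrow> col s = col k \<Longrightarrow> R s m \<Longrightarrow>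
         m \<in> {lo..<hi} \<and> \<not> bad s m \<and> \<not> bad m s" by metis
  \<comment> \<open>Possible left and right ends of a one-coloured interval around \<open>k\<close>
    inside the region; the extreme ones bound the maximal run.\<close>
  define Pp where "Pp p \<longleftrightarrow> lo \<le> p \<and> p \<le> k \<and> (\<forall>x. p \<le> x \<and> x \<le> k \<longrightarrow> col x = col k)" for p
  define Pq where "Pq q \<longleftrightarrow> k < q \<and> q \<le> hi \<and> (\<forall>x. k \<le> x \<and> x < q \<longrightarrow> col x = col k)" for q
  define p where "p = (LEAST p. Pp p)"
  define q where "q = (GREATEST q. Pq q)"
  have "Pp k" "Pq (Suc k)" using k by (auto simp: Pp_def Pq_def le_less_Suc_eq)
  then have p: "Pp p" "\<And>x. Pp x \<Longrightarrow> p \<le> x"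
    unfolding p_def by (auto intro: LeastI Least_le)
  have "\<forall>y. Pq y \<longrightarrow> y \<le> hi" by (simp add: Pq_def)
  then have q: "Pq q"
    unfolding q_def by (intro GreatestI_nat[of Pq "Suc k" hi] \<open>Pq (Suc k)\<close>) blast
  have q_max: "x \<le> q" if "Pq x" for x
    unfolding q_def using \<open>\<forall>y. Pq y \<longrightarrow> y \<le> hi\<close> that by (intro Greatest_le_nat[of Pq x hi]) blast+
  have pq_col: "col x = col k" if "x \<in> {p..<q}" for x
    using p(1) q that unfolding Pp_def Pq_def by (meson atLeastLessThan_iff linear)
  have bounds: "lo \<le> p" "p \<le> k" "k < q" "q \<le> hi"
    using p(1) q unfolding Pp_def Pq_def by blast+
  have "j \<in> {p..<q}" if i: "i \<in> {p..<q}" "j < n" "R i j" for i j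
  proof -
    have ic: "i \<in> {lo..<hi}" "col i = col k" using i(1) pq_col[OF i(1)] bounds by auto
    then have j: "j \<in> {lo..<hi}" "\<not> bad i j" "\<not> bad j i"
      using region[OF ic(1) i(2) ic(2) i(3)] by auto
    have "i < n" using ic(1) k(3) by auto
    then have cj: "col j = col k" using col[OF _ i(2,3)] ic(2) by simp
    \<comment> \<open>As the pair is not bad in either order, the whole stretch from
      \<open>i\<close> to \<open>j\<close> has one colour. If \<open>j\<close> lay outside the run,
      the run could be extended up to \<open>j\<close>.\<close>
    have between: "col x = col k" if x: "min i j \<le> x" "x \<le> max i j" for x
    proof (cases "x = i \<or> x = j")
      case False
      then consider "i < x" "x < j" | "j < x" "x < i" using x by fastforce
      then show ?thesis
        using j(2,3) ic(2) cj i(2) i(3) sym[OF i(3)] \<open>i < n\<close> unfolding bad_def by cases (metis less_trans)+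
    qed (use ic cj in auto)
    have "p \<le> j"
    proof (cases "j < p")
      case True
      have "Pp j" unfolding Pp_def
      proof (intro conjI allI impI)
        fix x assume "j \<le> x \<and> x \<le> k"
        then show "col x = col k" using between[of x] pq_col[of x] i(1) bounds
          by (cases "x \<le> i") auto
      qed (use j(1) True bounds in auto)
      then show ?thesis using p(2) by blast
    qed simp
    moreover have "j < q"
    proof (cases "q \<le> j")
      case True
      have "Pq (Suc j)" unfolding Pq_def
      proof (intro conjI allI impI)
        fix x assume "k \<le> x \<and> x < Suc j"
        then show "col x = col k" using between[of x] pq_col[of x] i(1) bounds
          by (cases "x < i") auto
      qed (use j(1) True bounds in auto)
      then show ?thesis using q_max by fastforce
    qed simp
    ultimately show ?thesis by simp
  qed
  moreover have "\<exists>y<n. y \<notin> {p..<q}" using two pq_col by metis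
  moreover have "p < q" "q \<le> n" using bounds k by auto
  ultimately show ?thesis by blast
qed

subsection \<open>Joins and noncrossing edge sets\<close>

text \<open>Follow a walk of \<open>G\<close> to \<open>v\<close> that starts in \<open>W\<close>.
  Until it reaches \<open>v\<close>, each edge it uses shares a vertex other than \<open>v\<close>
  with an edge of \<open>D\<close> and therefore lies in \<open>D\<close>, so the walk stays in the
  subgraph.\<close>

lemma bridge_subgraph:
  assumes rg: "ribbon_graph G" and conn: "connected_rg G" and v: "v \<in> verts G"
    and D: "D \<subseteq> edges G" and closed: "\<And>e f. e \<in> D \<Longrightarrow> (e, f) \<in> off G v \<Longrightarrow> f \<in> D"
  defines "W \<equiv> insert v {w. \<exists>e\<in>D. incident G e w}"
  shows "ribbon_subgraph (restrict G W D) G \<and> connected_rg (restrict G W D)"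
proof -
  let ?P = "restrict G W D"
  have W: "W \<subseteq> verts G" using v by (auto simp: W_def incident_iff)
  have rP: "ribbon_graph ?P" using W D by (intro ribbon_graph_restrict[OF rg]) (auto simp: W_def)
  have vP: "verts ?P = W" "edges ?P = D" by (auto simp: restrict_def)
  have to_v: "w \<in> W \<longrightarrow> (w, v) \<in> (adjacency ?P)\<^sup>*" if "(w, v) \<in> (adjacency G)\<^sup>*" for w
    using that
  proof (induction rule: converse_rtrancl_induct)
    case (step w w')
    show ?case
    proof (cases "w = v")
      case False
      obtain e where e: "e \<in> edges G" "incident G e w" "incident G e w'"
        using step(1) by (auto simp: adjacency_def)
      show ?thesis
      proof
        assume "w \<in> W"
        then obtain f where "f \<in> D" "incident G f w" using False by (auto simp: W_def)
        then have "e \<in> D" using closed[of f e] e False by (auto simp: off_def)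
        then have "w' \<in> W" using e by (auto simp: W_def)
        then have "incident ?P e w" "incident ?P e w'"
          using incident_restrict[OF rg W, of D e] e \<open>e \<in> D\<close> \<open>w \<in> W\<close> by blast+
        then have "(w, w') \<in> adjacency ?P" unfolding adjacency_def using vP(2) \<open>e \<in> D\<close> by blast
        then show "(w, v) \<in> (adjacency ?P)\<^sup>*"
          using step(3) \<open>w' \<in> W\<close> by (meson converse_rtrancl_into_rtrancl)
      qed
    qed simp
  qed simp
  have "sym (adjacency ?P)" by (auto simp: adjacency_def sym_def)
  then have symP: "sym ((adjacency ?P)\<^sup>*)" by (rule sym_rtrancl)
  have "(w, v) \<in> (adjacency ?P)\<^sup>*" if "w \<in> W" for w
    using to_v[of w] that W v conn by (auto simp: connected_rg_def)
  then have "(u, w) \<in> (adjacency ?P)\<^sup>*" if "u \<in> W" "w \<in> W" for u w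
    using that symP by (meson rtrancl_trans symD)
  then show ?thesis using rP W D vP by (auto simp: ribbon_subgraph_def connected_rg_def W_def)
qed

text \<open>\<open>P\<close> collects the bridges at \<open>v\<close> that meet \<open>l1\<close>,
  and \<open>Q\<close> all the other edges. Being unions of bridges they share only
  \<open>v\<close>, and rotating by \<open>length l0\<close> exhibits \<open>l1\<close> as the arc
  of the join.\<close>

lemma join_of_closed_segment:
  assumes rg: "ribbon_graph G" and conn: "connected_rg G"
    and rot: "rot G v = l0 @ l1 @ l2" and ne: "l1 \<noteq> []" "l0 @ l2 \<noteq> []"
    and closed: "\<And>x y. x \<in> set l1 \<Longrightarrow> y \<in> set (l0 @ l2) \<Longrightarrow> (fst x, fst y) \<notin> (off G v)\<^sup>*"
  shows "\<exists>P Q. join_rg G P Q"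
proof -
  define D where "D = {e \<in> edges G. \<exists>x \<in> set l1. (fst x, e) \<in> (off G v)\<^sup>*}"
  define D' where "D' = edges G - D"
  define V where "V F = insert v {w. \<exists>e\<in>F. incident G e w}" for F
  have v: "v \<in> verts G" using rot_vert[OF rg] ne(1) rot by (metis Un_iff last_in_set set_append)
  have off_edges: "f \<in> edges G" if "(e, f) \<in> off G v" for e f
    using that incident_edges[OF rg] by (auto simp: off_def)
  have cl: "f \<in> D" if "e \<in> D" "(e, f) \<in> off G v" for e f
    using that off_edges unfolding D_def by (auto intro: rtrancl_into_rtrancl)
  have sym: "(f, e) \<in> off G v" if "(e, f) \<in> off G v" for e f
    using that by (auto simp: off_def)
  have cl': "f \<in> D'" if "e \<in> D'" "(e, f) \<in> off G v" for e f
    using that cl sym off_edges unfolding D'_def by blast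
  have l1: "fst ` set l1 \<subseteq> D" using rot_edges[OF rg, of _ v] rot by (auto simp: D_def)
  have l02: "fst ` set (l2 @ l0) \<subseteq> D'"
    using rot_edges[OF rg, of _ v] rot closed by (fastforce simp: D_def D'_def)
  have sub: "D \<subseteq> edges G" "D' \<subseteq> edges G" by (auto simp: D_def D'_def)
  let ?P = "restrict G (V D) D" and ?Q = "restrict G (V D') D'"
  have PQ: "ribbon_subgraph ?P G" "connected_rg ?P" "ribbon_subgraph ?Q G" "connected_rg ?Q"
    using bridge_subgraph[OF rg conn v sub(1) cl] bridge_subgraph[OF rg conn v sub(2) cl']
    unfolding V_def by auto
  have ne': "D \<noteq> {}" "D' \<noteq> {}" using l1 l02 ne by (auto simp: neq_Nil_conv)
  have "w \<in> V D \<union> V D'" if "w \<in> verts G" for w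
  proof (cases "w = v")
    case False
    have "(w, v) \<in> (adjacency G)\<^sup>*" using conn that v by (auto simp: connected_rg_def)
    then obtain w' where "(w, w') \<in> adjacency G" using False by (meson converse_rtranclE)
    then show ?thesis using sub by (auto simp: V_def adjacency_def D'_def)
  qed (simp add: V_def)
  moreover have "V D \<union> V D' \<subseteq> verts G" using v by (auto simp: V_def incident_iff)
  moreover have "V D \<inter> V D' = {v}"
    using cl unfolding V_def D'_def by (auto simp: off_def)
  ultimately have "one_sum_at G ?P ?Q v"
    unfolding one_sum_at_def using rg conn PQ ne' by (auto simp: restrict_def D'_def D_def)
  moreover have "rotate (length l0) (rot G v) = l1 @ (l2 @ l0)"
    by (simp add: rot rotate_append)
  moreover have "edges ?P = D" "edges ?Q = D'" by (simp_all add: restrict_def)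
  ultimately have "join_rg G ?P ?Q"
    unfolding join_rg_def using l1 l02
    by (intro exI[of _ v] exI[of _ "length l0"] exI[of _ l1] exI[of _ "l2 @ l0"] conjI) simp_all
  then show ?thesis by blast
qed

text \<open>The complementary arc carries the segments of \<open>Q\<close>; rotating further by
  \<open>length ps\<close> brings it to the front.\<close>

lemma join_rg_sym: "join_rg G P Q \<Longrightarrow> join_rg G Q P"
proof -
  assume "join_rg G P Q"
  then obtain v where v: "one_sum_at G P Q v" "\<exists>n ps qs. rotate n (rot G v) = ps @ qs \<and>
    fst ` set ps \<subseteq> edges P \<and> fst ` set qs \<subseteq> edges Q"
    unfolding join_rg_def by metis
  from v(2) obtain n ps qs where "rotate n (rot G v) = ps @ qs"
    "fst ` set ps \<subseteq> edges P" "fst ` set qs \<subseteq> edges Q" by metis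
  note o = v(1) this
  have "rotate (length ps + n) (rot G v) = qs @ ps"
    using o(2) by (metis rotate_append rotate_rotate)
  moreover have "one_sum_at G Q P v" using o(1) unfolding one_sum_at_def by blast
  ultimately show ?thesis unfolding join_rg_def using o(3,4) by (intro exI conjI)
qed

text \<open>Join sequences associate to the left, so a sequence for the left summand
  \<open>P\<close> becomes one for \<open>G\<close> by appending \<open>Q\<close>, with the old
  summands still available for toggling. The right summand is reached through
  \<open>join_rg_sym\<close>.\<close>

lemma toggle_related_join_left:
  assumes j: "join_rg G P Q" and "toggle_related P X Y" and X0: "X0 \<subseteq> edges Q" and Y: "X \<subseteq> edges P"
  shows "toggle_related G (X \<union> X0) (Y \<union> X0)"
proof -
  have e: "edges P \<inter> edges Q = {}" "edges P \<union> edges Q = edges G"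
    using j by (auto simp: join_rg_def one_sum_at_def)
  have sub: "edges H \<subseteq> edges K" if "join_seq K Hs" "H \<in> set Hs" for K :: "('a,'b) ribbon_graph" and Hs H
    using that by (induction) (auto simp: join_rg_def one_sum_at_def)
  show ?thesis using assms(2) unfolding toggle_related_def
  proof (induction rule: rtranclp_induct)
    case (step Y Z)
    obtain Hs H where H: "Y \<subseteq> edges P" "join_seq P Hs" "H \<in> set Hs" "Z = sym_diff Y (edges H)"
      using step(2) unfolding toggle_step_def by blast
    have "join_seq G (Hs @ [Q])" using H j by (auto intro: join_seq.snoc)
    moreover have "Z \<union> X0 = sym_diff (Y \<union> X0) (edges H)"
      using H sub[OF H(2,3)] e X0 by blast
    ultimately have "toggle_step G (Y \<union> X0) (Z \<union> X0)"
      unfolding toggle_step_def using H X0 e by (metis Un_mono Un_iff set_append)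
    then show ?case using step(3) by simp
  qed simp
qed

text \<open>Interlacing is a cyclic notion, but nothing is lost by reading the rotation from its
  starting point: moving \<open>a\<close> to the end of the list exchanges the two pairs, and the
  first clause makes the conclusions agree. The closure is reflexive, so the two segments of one
  loop count as related and a single loop can interlace with another bridge.\<close>

definition noncrossing_set :: "('v, 'e) ribbon_graph \<Rightarrow> 'e set \<Rightarrow> bool" where
  "noncrossing_set G C \<longleftrightarrow>
     (\<forall>u. \<forall>x \<in> set (rot G u). \<forall>y \<in> set (rot G u).
        (fst x, fst y) \<in> (off G u)\<^sup>* \<longrightarrow> (fst x \<in> C \<longleftrightarrow> fst y \<in> C)) \<and>
     (\<forall>u a b c d. subseq [a, b, c, d] (rot G u) \<longrightarrow> (fst a, fst c) \<in> (off G u)\<^sup>* \<longrightarrow>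
        (fst b, fst d) \<in> (off G u)\<^sup>* \<longrightarrow> (fst a \<in> C \<longleftrightarrow> fst b \<in> C))"

text \<open>Passing to \<open>P\<close> refines the bridges, because \<open>off P u\<close> is
  contained in \<open>off G u\<close>, and shortens rotations to sublists; both clauses are
  inherited.\<close>

lemma noncrossing_set_subgraph:
  assumes rg: "ribbon_graph G" and nc: "noncrossing_set G C" and P: "ribbon_subgraph P G"
  shows "noncrossing_set P (C \<inter> edges P)"
proof -
  have rP: "rot P u = (if u \<in> verts P then filter (\<lambda>x. fst x \<in> edges P) (rot G u) else [])" for u
  proof -
    have "P = restrict G (verts P) (edges P)" using P by (simp add: ribbon_subgraph_def)
    then have "rot P u = rot (restrict G (verts P) (edges P)) u" by (rule arg_cong)
    then show ?thesis by (simp add: restrict_def)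
  qed
  then have ss: "subseq (rot P u) (rot G u)" "fst ` set (rot P u) \<subseteq> edges P" "set (rot P u) \<subseteq> set (rot G u)" for u
    by auto
  have rgP: "ribbon_graph P" using P by (simp add: ribbon_subgraph_def)
  have "off P u \<subseteq> off G u" for u
    using ss(3) by (fastforce simp: off_def incident_rot[OF rg] incident_rot[OF rgP])
  then have "(off P u)\<^sup>* \<subseteq> (off G u)\<^sup>*" for u by (rule rtrancl_mono)
  then have off: "(e, f) \<in> (off P u)\<^sup>* \<Longrightarrow> (e, f) \<in> (off G u)\<^sup>*" for e f u by blast
  show ?thesis unfolding noncrossing_set_def
  proof (intro conjI allI ballI impI)
    fix u x y assume "x \<in> set (rot P u)" "y \<in> set (rot P u)" "(fst x, fst y) \<in> (off P u)\<^sup>*"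
    moreover from this have "fst x \<in> edges P" "fst y \<in> edges P" using ss(2) by auto
    ultimately show "(fst x \<in> C \<inter> edges P) = (fst y \<in> C \<inter> edges P)"
      using nc off ss(3) unfolding noncrossing_set_def by (metis Int_iff subsetD)
  next
    fix u a b c d assume a: "subseq [a, b, c, d] (rot P u)" "(fst a, fst c) \<in> (off P u)\<^sup>*"
      "(fst b, fst d) \<in> (off P u)\<^sup>*"
    have "subseq [a, b, c, d] (rot G u)" using a(1) ss(1) subseq_order.trans by blast
    then have "fst a \<in> C \<longleftrightarrow> fst b \<in> C" using nc a off unfolding noncrossing_set_def by metis
    moreover have "x \<in> set (rot P u)" if "x \<in> set [a, b, c, d]" for x
      using list_emb_set[OF a(1) that] by metis
    then have "a \<in> set (rot P u)" "b \<in> set (rot P u)" by (simp_all del: split_paired_All)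
    then have "fst a \<in> edges P" "fst b \<in> edges P"
      using ss(2)[of u] imageI[of a "set (rot P u)" fst] imageI[of b "set (rot P u)" fst] by auto
    ultimately show "(fst a \<in> C \<inter> edges P) = (fst b \<in> C \<inter> edges P)" by simp
  qed
qed

lemma subseq_nth_Cons_drop:
  assumes "k \<le> i" "i < length xs" "subseq ys (drop (Suc i) xs)"
  shows "subseq (xs ! i # ys) (drop k xs)"
proof -
  have "drop k xs = take (i - k) (drop k xs) @ xs ! i # drop (Suc i) xs"
    using assms id_take_nth_drop[of "i - k" "drop k xs"] by simp
  then show ?thesis using assms(3) by (metis subseq_Cons2 subseq_drop_many)
qed

lemma subseq_nth:
  assumes "a < b" "b < c" "c < d" "d < length xs"
  shows "subseq [xs ! a, xs ! b, xs ! c, xs ! d] xs"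
proof -
  have "subseq [xs ! a, xs ! b, xs ! c, xs ! d] (drop 0 xs)"
    using assms by (intro subseq_nth_Cons_drop) auto
  then show ?thesis by simp
qed

text \<open>If no vertex met both \<open>C\<close> and its complement, membership in
  \<open>C\<close> would spread along walks to all edges. At a vertex that meets both, the two
  colours required by \<open>closed_interval\<close> are present.\<close>

lemma noncrossing_set_join:
  assumes rg: "ribbon_graph G" and conn: "connected_rg G" and nc: "noncrossing_set G C"
    and C: "C \<subseteq> edges G" "C \<noteq> {}" "C \<noteq> edges G"
  shows "\<exists>P Q. join_rg G P Q"
proof -
  have "\<exists>v. (\<exists>x \<in> set (rot G v). fst x \<in> C) \<and> (\<exists>x \<in> set (rot G v). fst x \<notin> C)"
  proof (rule ccontr)
    assume mixed: "\<not> ?thesis"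
    have mono: "e \<in> C \<longleftrightarrow> f \<in> C" if "incident G e v" "incident G f v" for v e f
    proof -
      obtain x y where "x \<in> set (rot G v)" "y \<in> set (rot G v)" "e = fst x" "f = fst y"
        using \<open>incident G e v\<close> \<open>incident G f v\<close> by (auto simp: incident_rot[OF rg])
      then show ?thesis using mixed by blast
    qed
    obtain e f where ef: "e \<in> C" "f \<in> edges G" "f \<notin> C" using C by blast
    obtain u w where uw: "incident G e u" "incident G f w" using ef C edge_incident[OF rg] by blast
    have "(u, w) \<in> (adjacency G)\<^sup>*" using conn uw by (auto simp: connected_rg_def incident_iff)
    then have "\<forall>g. incident G g w \<longrightarrow> g \<in> C"
    proof (induction rule: rtrancl_induct)
      case (step y z)
      then show ?case using mono unfolding adjacency_def by blast
    qed (use mono uw ef in blast)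
    then show False using uw ef by blast
  qed
  then obtain v x y where v: "x \<in> set (rot G v)" "fst x \<in> C" "y \<in> set (rot G v)" "fst y \<notin> C" by blast
  define r where "r = rot G v"
  let ?R = "\<lambda>i j. (fst (r ! i), fst (r ! j)) \<in> (off G v)\<^sup>*"
  have "\<exists>p q. p < q \<and> q \<le> length r \<and> (\<exists>y<length r. y \<notin> {p..<q}) \<and>
    (\<forall>i\<in>{p..<q}. \<forall>j<length r. ?R i j \<longrightarrow> j \<in> {p..<q})"
  proof (rule closed_interval[of ?R _ "\<lambda>i. fst (r ! i) \<in> C"])
    show "?R i j \<Longrightarrow> ?R j i" for i j by (rule sym_off[OF rg])
    show "(fst (r ! i) \<in> C) = (fst (r ! j) \<in> C)" if "i < length r" "j < length r" "?R i j" for i j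
      using nc that unfolding noncrossing_set_def r_def by (meson nth_mem)
    show "(fst (r ! a) \<in> C) = (fst (r ! b) \<in> C)"
      if "a < b" "b < c" "c < d" "d < length r" "?R a c" "?R b d" for a b c d
      using nc subseq_nth[OF that(1-4)] that(5,6) unfolding noncrossing_set_def r_def by blast
    show "\<exists>i<length r. fst (r ! i) \<in> C" "\<exists>i<length r. fst (r ! i) \<notin> C"
      using v unfolding r_def in_set_conv_nth by blast+
  qed
  then obtain p q where pq: "p < q" "q \<le> length r" "\<exists>y<length r. y \<notin> {p..<q}"
    and cl: "\<And>i j. i \<in> {p..<q} \<Longrightarrow> j < length r \<Longrightarrow> ?R i j \<Longrightarrow> j \<in> {p..<q}" by blast
  define l0 l1 l2 where "l0 = take p r" and "l1 = take (q - p) (drop p r)" and "l2 = drop q r"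
  have "drop p r = l1 @ l2"
    using pq append_take_drop_id[of "q - p" "drop p r"] by (simp add: l1_def l2_def)
  then have "r = l0 @ l1 @ l2" by (metis append_take_drop_id l0_def)
  moreover have "l1 \<noteq> []" using pq by (auto simp: l1_def)
  moreover have "l0 @ l2 \<noteq> []"
    using pq by (auto simp: l0_def l2_def)
  moreover have "(fst x, fst y) \<notin> (off G v)\<^sup>*" if xy: "x \<in> set l1" "y \<in> set (l0 @ l2)" for x y
  proof -
    obtain i where "i < q - p" "x = r ! (p + i)" using xy(1) pq by (auto simp: l1_def in_set_conv_nth)
    moreover have "\<exists>j. j < length r \<and> y = r ! j \<and> j \<notin> {p..<q}"
    proof (cases "y \<in> set l0")
      case True
      then obtain i where "i < p" "i < length r" "y = r ! i" by (auto simp: l0_def in_set_conv_nth)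
      then show ?thesis by (intro exI[of _ i]) auto
    next
      case False
      then have "y \<in> set l2" using xy(2) by simp
      then obtain i where "i < length r - q" "y = r ! (q + i)" using pq by (auto simp: l2_def in_set_conv_nth)
      then show ?thesis by (intro exI[of _ "q + i"]) auto
    qed
    ultimately show ?thesis using cl[of "p + i"] pq by fastforce
  qed
  ultimately show ?thesis using join_of_closed_segment[OF rg conn] unfolding r_def by blast
qed

text \<open>Induction on the number of edges. The extreme case \<open>C = edges G\<close> is a
  single toggle, with the join sequence consisting of \<open>G\<close> alone. Otherwise both
  summands of a join have fewer edges: first toggle the part of \<open>C\<close> in \<open>P\<close>
  while \<open>A\<close> is frozen on \<open>Q\<close>, then the part in \<open>Q\<close>.\<close>

lemma toggle_related_sym_diff:
  assumes "ribbon_graph G" "connected_rg G" "noncrossing_set G C" "C \<subseteq> edges G" "A \<subseteq> edges G"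
  shows "toggle_related G A (sym_diff A C)"
  using assms
proof (induction "card (edges G)" arbitrary: G A C rule: less_induct)
  case less
  note rg = less.prems(1) and conn = less.prems(2) and nc = less.prems(3)
  show ?case
  proof (cases "C = {} \<or> C = edges G")
    case True
    moreover have "toggle_step G A (sym_diff A (edges G))"
      unfolding toggle_step_def using less.prems join_seq.single[of G] by (metis list.set_intros(1))
    ultimately show ?thesis unfolding toggle_related_def by auto
  next
    case False
    then obtain P Q where j: "join_rg G P Q" using noncrossing_set_join[OF rg conn nc] less.prems by blast
    then have PQ: "ribbon_subgraph P G" "connected_rg P" "edges P \<noteq> {}" "ribbon_subgraph Q G"
      "connected_rg Q" "edges Q \<noteq> {}" "edges P \<union> edges Q = edges G" "edges P \<inter> edges Q = {}"
      by (auto simp: join_rg_def one_sum_at_def)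
    have rPQ: "ribbon_graph P" "ribbon_graph Q" using PQ by (auto simp: ribbon_subgraph_def)
    have "edges P \<subset> edges G" "edges Q \<subset> edges G" using PQ by auto
    then have lt: "card (edges P) < card (edges G)" "card (edges Q) < card (edges G)"
      using finite_edges[OF rg] by (auto intro: psubset_card_mono)
    let ?AP = "A \<inter> edges P" and ?AQ = "A \<inter> edges Q"
    let ?BP = "sym_diff ?AP (C \<inter> edges P)" and ?BQ = "sym_diff ?AQ (C \<inter> edges Q)"
    have "toggle_related P ?AP ?BP"
      by (rule less.hyps) (use lt PQ rPQ noncrossing_set_subgraph[OF rg nc] in auto)
    then have 1: "toggle_related G (?AP \<union> ?AQ) (?BP \<union> ?AQ)"
      by (rule toggle_related_join_left[OF j]) auto
    have "toggle_related Q ?AQ ?BQ"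
      by (rule less.hyps) (use lt PQ rPQ noncrossing_set_subgraph[OF rg nc] in auto)
    then have "toggle_related G (?AQ \<union> ?BP) (?BQ \<union> ?BP)"
      by (rule toggle_related_join_left[OF join_rg_sym[OF j]]) auto
    with 1 have "toggle_related G (?AP \<union> ?AQ) (?BP \<union> ?BQ)"
      unfolding toggle_related_def by (simp add: Un_commute)
    moreover have "?AP \<union> ?AQ = A" "?BP \<union> ?BQ = sym_diff A C"
      using PQ less.prems by blast+
    ultimately show ?thesis by simp
  qed
qed

subsection \<open>Cycles through a vertex\<close>

text \<open>A path that leaves \<open>u\<close> by \<open>e\<close> and never returns to
  \<open>u\<close>, so that it stays in the bridge of \<open>e\<close>. Its edges and its vertices
  other than \<open>u\<close> are kept as sets, because only degrees are read off from it.\<close>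

inductive path_from :: "('v, 'e) ribbon_graph \<Rightarrow> 'v \<Rightarrow> 'e \<Rightarrow> 'v \<Rightarrow> 'e set \<Rightarrow> 'v set \<Rightarrow> bool"
  for G u e where
  start: "incident G e u \<Longrightarrow> incident G e w \<Longrightarrow> w \<noteq> u \<Longrightarrow> path_from G u e w {e} {w}"
| step: "path_from G u e w Z W \<Longrightarrow> incident G g w \<Longrightarrow> incident G g z \<Longrightarrow> z \<noteq> u \<Longrightarrow> z \<notin> W \<Longrightarrow>
    path_from G u e z (insert g Z) (insert z W)"

lemma path_from_prefix:
  assumes "path_from G u e w Z W" "z \<in> W"
  shows "\<exists>Z' W'. path_from G u e z Z' W'"
  using assms
proof induction
  case (start w)
  then show ?case using path_from.start by fastforce
next
  case (step w Z W g z')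
  then show ?case using path_from.step by (metis insert_iff)
qed

text \<open>Follow the chain of edges from \<open>e\<close> to \<open>f\<close>. When the next
  vertex has already been visited, the prefix of the path up to that vertex takes over.\<close>

lemma path_from_exists:
  assumes rg: "ribbon_graph G" and e: "incident G e u"
    and "(e, f) \<in> (off G u)\<^sup>*" "incident G f w" "w \<noteq> u"
  shows "\<exists>Z W. path_from G u e w Z W"
  using assms(3-)
proof (induction arbitrary: w rule: rtrancl_induct)
  case base
  then show ?case using path_from.start e by metis
next
  case (step f g)
  obtain x where x: "x \<noteq> u" "incident G f x" "incident G g x" using step(2) by (auto simp: off_def)
  obtain Z W where ZW: "path_from G u e x Z W" using step(3) x by blast
  then show ?case
  proof (cases "w \<in> W")
    case True
    then show ?thesis using path_from_prefix ZW by metis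
  next
    case False
    then show ?thesis using path_from.step[OF ZW x(3)] step by blast
  qed
qed

lemma path_from_degrees:
  assumes rg: "ribbon_graph G" and "path_from G u e w Z W"
  shows "e \<in> Z \<and> Z \<subseteq> {f. (e, f) \<in> (off G u)\<^sup>*} \<and> Z \<subseteq> edges G \<and> u \<notin> W \<and> w \<in> W \<and>
    deg G Z u = 1 \<and> deg G Z w = 1 \<and> (\<forall>v \<in> W - {w}. deg G Z v = 2) \<and> (\<forall>v. v \<notin> insert u W \<longrightarrow> deg G Z v = 0)"
  using assms(2)
proof induction
  case (start w)
  then show ?case using edge_two_ends[OF rg start(1,2)] incident_edges[OF rg] by auto
next
  case (step w Z W g z)
  then have IH: "e \<in> Z" "Z \<subseteq> {f. (e, f) \<in> (off G u)\<^sup>*}" "Z \<subseteq> edges G" "u \<notin> W" "w \<in> W"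
    "deg G Z u = 1" "deg G Z w = 1" "\<forall>v \<in> W - {w}. deg G Z v = 2" "\<forall>v. v \<notin> insert u W \<longrightarrow> deg G Z v = 0"
    by auto
  have wz: "w \<noteq> z" "w \<noteq> u" "z \<in> verts G" "w \<in> verts G" using step IH by (auto simp: incident_iff)
  have g: "deg G {g} w = 1" "deg G {g} z = 1" "\<And>v. v \<noteq> w \<Longrightarrow> v \<noteq> z \<Longrightarrow> deg G {g} v = 0"
    using edge_two_ends[OF rg step(2,3) wz(1)] by auto
  have gZ: "g \<notin> Z"
  proof
    assume "g \<in> Z"
    then have "deg G {g} z \<le> deg G Z z" by (intro deg_mono) auto
    then show False using g IH step by auto
  qed
  have "\<exists>f \<in> Z. incident G f w"
  proof -
    have "\<exists>x \<in> set (rot G w). fst x \<in> Z" using IH(7) deg_eq_0_iff[of G Z w] by auto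
    then show ?thesis by (auto simp: incident_rot[OF rg])
  qed
  then obtain f where "f \<in> Z" "incident G f w" by blast
  then have "(f, g) \<in> off G u" using step wz by (auto simp: off_def)
  then have "(e, g) \<in> (off G u)\<^sup>*" using IH(2) \<open>f \<in> Z\<close> rtrancl_into_rtrancl[of e f "off G u" g] by blast
  have "deg G (insert g Z) v = deg G {g} v + deg G Z v" for v
    by (rule deg_insert[OF gZ])
  note d = this
  have "g \<in> edges G" by (rule incident_edges[OF rg step(2)])
  moreover have "deg G (insert g Z) v = 2" if "v \<in> W" for v
    using d[of v] g IH that step(5) by (cases "v = w") auto
  moreover have "deg G (insert g Z) v = 0" if "v \<notin> insert u (insert z W)" for v
    using d[of v] g(3)[of v] IH that by auto
  moreover have "deg G (insert g Z) u = 1" "deg G (insert g Z) z = 1"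
    using d[of u] d[of z] g IH step(4,5) wz by auto
  ultimately show ?case using IH(1-4) \<open>(e, g) \<in> (off G u)\<^sup>*\<close> step(4,5) by auto
qed

text \<open>At each inner vertex exactly two edges of the path meet, so a subset with even degree
  there takes both or neither, and this choice propagates along the path.\<close>

lemma path_from_minimal:
  assumes rg: "ribbon_graph G" and "path_from G u e w Z W"
    and "Z' \<subseteq> Z" "\<And>v. v \<noteq> u \<Longrightarrow> v \<noteq> w \<Longrightarrow> even (deg G Z' v)"
  shows "Z' = {} \<or> Z' = Z"
  using assms(2-)
proof (induction arbitrary: Z')
  case (step w Z W g z)
  have Z: "u \<notin> W" "w \<in> W" "deg G Z w = 1" "\<And>v. v \<notin> insert u W \<Longrightarrow> deg G Z v = 0"
    using path_from_degrees[OF rg step(1)] by auto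
  have wz: "w \<noteq> z" "w \<noteq> u" using step Z by auto
  have g: "deg G {g} w = 1" "deg G {g} z = 1" "\<And>v. v \<noteq> w \<Longrightarrow> v \<noteq> z \<Longrightarrow> deg G {g} v = 0"
    using edge_two_ends[OF rg step(2,3) wz(1)] by auto
  define Y where "Y = Z' - {g}"
  have Y: "Y \<subseteq> Z" using step by (auto simp: Y_def)
  have d: "deg G Z' v = (if g \<in> Z' then deg G {g} v else 0) + deg G Y v" for v
  proof (cases "g \<in> Z'")
    case True
    then have "Z' = insert g Y" by (auto simp: Y_def)
    moreover have "g \<notin> Y" by (simp add: Y_def)
    ultimately show ?thesis using True deg_insert[of g Y G v] by simp
  qed (simp add: Y_def)
  have dz: "deg G Y z = 0" using deg_mono[OF Y, of G z] Z(4)[of z] step by auto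
  have "even (deg G Y v)" if "v \<noteq> u" "v \<noteq> w" for v
  proof (cases "v = z")
    case False
    then show ?thesis using step.prems(2)[of v] that d[of v] g(3)[of v] by (auto split: if_splits)
  qed (use dz in simp)
  then have "Y = {} \<or> Y = Z" using step.IH[OF Y] by blast
  moreover have "even (deg G Z' w)" using step.prems(2) wz by auto
  ultimately show ?case
  proof (elim disjE)
    assume Y0: "Y = {}" and "even (deg G Z' w)"
    then have "g \<notin> Z'" using d[of w] g by (auto split: if_splits)
    then show ?thesis using Y0 by (simp add: Y_def)
  next
    assume Y0: "Y = Z" and "even (deg G Z' w)"
    then have "g \<in> Z'" using d[of w] Z by (auto split: if_splits)
    then show ?thesis using Y0 by (auto simp: Y_def)
  qed
qed auto

text \<open>The last clause is what puts a cycle on a single side of a biseparation: its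
  intersection with each summand is an even set.\<close>

definition cycle_at :: "('v, 'e) ribbon_graph \<Rightarrow> 'v \<Rightarrow> 'e set \<Rightarrow> bool" where
  "cycle_at G u Z \<longleftrightarrow> Z \<subseteq> edges G \<and> deg G Z u = 2 \<and> (\<forall>v. deg G Z v \<in> {0, 2}) \<and>
     (\<forall>Z' \<subseteq> Z. even_set G Z' \<longrightarrow> Z' = {} \<or> Z' = Z)"

text \<open>A loop at \<open>u\<close> is itself a cycle; two different edges are joined by a path
  inside their bridge. The hypothesis speaks of a sublist rather than of membership because an
  untwisted loop contributes two equal entries to the rotation, which must be known to occupy two
  positions.\<close>

lemma cycle_at_exists:
  assumes rg: "ribbon_graph G" and ss: "subseq [x, y] (rot G u)"
    and xy: "(fst x, fst y) \<in> (off G u)\<^sup>*"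
  shows "\<exists>Z. cycle_at G u Z \<and> fst x \<in> Z \<and> fst y \<in> Z \<and> Z \<subseteq> {f. (fst x, f) \<in> (off G u)\<^sup>*}"
proof (cases "fst x = fst y")
  case True
  have "subseq (filter (\<lambda>z. fst z \<in> {fst x}) [x, y]) (filter (\<lambda>z. fst z \<in> {fst x}) (rot G u))"
    using ss by (rule subseq_filter)
  then have "deg G {fst x} u \<ge> 2" using True unfolding deg_def
    by (metis (mono_tags, lifting) filter.simps length_Cons list.size(3) list_emb_length numeral_2_eq_2 singleton_iff)
  moreover have u: "u \<in> verts G" and e: "fst x \<in> edges G"
    using ss rot_vert[OF rg] rot_edges[OF rg] by (metis subseq_singleton_left subseq_Cons' list_emb_Cons2 subseq_order.trans list_emb_set list.set_intros(1))+
  have "deg G {fst x} u + (\<Sum>v \<in> verts G - {u}. deg G {fst x} v) = 2"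
    using deg_edge[OF rg e] u finite_verts[OF rg] by (simp add: sum.remove)
  ultimately have d: "deg G {fst x} u = 2" "(\<Sum>v \<in> verts G - {u}. deg G {fst x} v) = 0" by auto
  then have "deg G {fst x} v = 0" if "v \<noteq> u" for v
    using that finite_verts[OF rg] deg_outside[OF rg] by (cases "v \<in> verts G") auto
  then have "deg G {fst x} v = 0 \<or> deg G {fst x} v = 2" for v using d by (cases "v = u") auto
  then have "cycle_at G u {fst x}" unfolding cycle_at_def using d e by (auto simp: subset_singleton_iff)
  then show ?thesis using True by (intro exI[of _ "{fst x}"]) auto
next
  case False
  let ?e = "fst x" and ?f = "fst y"
  have mem: "x \<in> set (rot G u)" "y \<in> set (rot G u)" using list_emb_set[OF ss] by (metis list.set_intros)+
  then have inc: "incident G ?e u" "incident G ?f u" by (auto simp: incident_rot[OF rg])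
  \<comment> \<open>The last step of the chain supplies the vertex \<open>w\<close> other than
    \<open>u\<close> at which \<open>?f\<close> closes the path.\<close>
  obtain g where g: "(?e, g) \<in> (off G u)\<^sup>*" "(g, ?f) \<in> off G u" using xy False by (metis rtranclE)
  then obtain w where w: "w \<noteq> u" "incident G g w" "incident G ?f w" by (auto simp: off_def)
  obtain Z W where ZW: "path_from G u ?e w Z W" using path_from_exists[OF rg inc(1) g(1) w(2,1)] by blast
  note Z = path_from_degrees[OF rg ZW]
  have df: "deg G {?f} u = 1" "deg G {?f} w = 1" "\<And>v. v \<noteq> u \<Longrightarrow> v \<noteq> w \<Longrightarrow> deg G {?f} v = 0"
    using edge_two_ends[OF rg inc(2) w(3)] w(1) by auto
  \<comment> \<open>The path has degree 1 at \<open>u\<close>, and \<open>?e\<close> already uses it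
    up.\<close>
  have fZ: "?f \<notin> Z"
  proof
    assume "?f \<in> Z"
    then have "deg G {?e, ?f} u \<le> deg G Z u" using Z by (intro deg_mono) auto
    moreover have "deg G {?e} u > 0" using inc by (simp add: incident_deg)
    ultimately show False using Z df deg_insert[of ?e "{?f}" G u] False by auto
  qed
  define Y where "Y = insert ?f Z"
  have dY: "deg G Y v = deg G {?f} v + deg G Z v" for v
    unfolding Y_def by (rule deg_insert[OF fZ])
  have "Z' = {} \<or> Z' = Y" if Z': "Z' \<subseteq> Y" "even_set G Z'" for Z'
  proof -
    define X where "X = Z' - {?f}"
    have d: "deg G Z' v = (if ?f \<in> Z' then deg G {?f} v else 0) + deg G X v" for v
    proof (cases "?f \<in> Z'")
      case True
      then have "Z' = insert ?f X" by (auto simp: X_def)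
      moreover have "?f \<notin> X" by (simp add: X_def)
      ultimately show ?thesis using True deg_insert[of ?f X G v] by simp
    qed (simp add: X_def)
    have X: "X \<subseteq> Z" using Z' by (auto simp: X_def Y_def)
    have ev: "even (deg G Z' v)" for v using Z' by (auto simp: even_set_def)
    have "even (deg G X v)" if "v \<noteq> u" "v \<noteq> w" for v
      using ev[of v] d[of v] df(3)[OF that] by (auto split: if_splits)
    then have "X = {} \<or> X = Z" using path_from_minimal[OF rg ZW X] by blast
    then show ?thesis
    proof
      assume "X = {}"
      then have "?f \<notin> Z'" using d[of u] df ev[of u] by (auto split: if_splits)
      then show ?thesis using \<open>X = {}\<close> by (simp add: X_def)
    next
      assume "X = Z"
      then have "?f \<in> Z'" using d[of u] Z ev[of u] by (auto split: if_splits)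
      then show ?thesis using \<open>X = Z\<close> by (auto simp: X_def Y_def)
    qed
  qed
  moreover have "deg G Y v \<in> {0, 2}" for v
    using dY[of v] Z df by (cases "v = u"; cases "v = w"; cases "v \<in> W") auto
  moreover have "deg G Y u = 2" using dY[of u] Z df by auto
  ultimately have "cycle_at G u Y"
    unfolding cycle_at_def using Z incident_edges[OF rg inc(2)] by (auto simp: Y_def)
  then show ?thesis using Z xy by (intro exI[of _ Y]) (auto simp: Y_def)
qed

lemma cycle_at_even: "cycle_at G u Z \<Longrightarrow> even_set G Z"
proof -
  assume "cycle_at G u Z"
  then have "deg G Z v = 0 \<or> deg G Z v = 2" for v unfolding cycle_at_def by blast
  then have "even (deg G Z v)" for v by (metis even_numeral even_zero)
  then show ?thesis by (simp add: even_set_def)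
qed

subsection \<open>Biseparations split cycles\<close>

text \<open>A vertex other than \<open>x\<close> lies on one side only, so there the degree of
  \<open>Z\<close> is either kept or lost entirely. The parity at \<open>x\<close> is then
  forced.\<close>

lemma one_sum_at_even_set:
  assumes o: "one_sum_at G P Q x" and Z: "even_set G Z" "Z \<subseteq> edges G"
  shows "even_set G (Z \<inter> edges P)"
proof (rule even_set_except_vertex[of _ x])
  show rg: "ribbon_graph G" using o by (simp add: one_sum_at_def)
  fix v assume v: "v \<in> verts G" "v \<noteq> x"
  have PQ: "ribbon_subgraph P G" "ribbon_subgraph Q G" "edges P \<union> edges Q = edges G"
    "verts P \<inter> verts Q = {x}" using o by (auto simp: one_sum_at_def)
  have in_verts: "v \<in> verts H" if "y \<in> set (rot G v)" "fst y \<in> edges H" "ribbon_subgraph H G" for y H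
  proof -
    have "incident G (fst y) v" using that by (simp add: incident_rot[OF rg])
    then show ?thesis using subgraph_incident[OF rg that(3,2)] by (auto simp: incident_iff)
  qed
  show "even (deg G (Z \<inter> edges P) v)"
  proof (cases "v \<in> verts P")
    case True
    then have "v \<notin> verts Q" using PQ v by auto
    then have "fst y \<in> edges P" if "y \<in> set (rot G v)" for y
      using that in_verts PQ rot_edges[OF rg] by (metis Un_iff)
    then have "filter (\<lambda>y. fst y \<in> Z \<inter> edges P) (rot G v) = filter (\<lambda>y. fst y \<in> Z) (rot G v)"
      by (intro filter_cong) auto
    then have "deg G (Z \<inter> edges P) v = deg G Z v" by (simp add: deg_def)
    then show ?thesis using Z by (simp add: even_set_def)
  next
    case False
    then have "deg G (Z \<inter> edges P) v = 0" using in_verts PQ by (auto simp: deg_eq_0_iff)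
    then show ?thesis by simp
  qed
qed

lemma deg_subgraph:
  assumes rg: "ribbon_graph G" and "ribbon_subgraph H G" "Z \<subseteq> edges H"
  shows "deg H Z v = deg G Z v"
proof -
  have H: "H = restrict G (verts H) (edges H)" using assms by (simp add: ribbon_subgraph_def)
  have "deg H Z v = (if v \<in> verts H then deg G Z v else 0)"
    using assms(3) by (subst H) (simp add: deg_restrict[OF rg] Int_absorb2)
  moreover have "deg G Z v = 0" if "v \<notin> verts H"
    unfolding deg_eq_0_iff
  proof
    fix y assume y: "y \<in> set (rot G v)"
    show "fst y \<notin> Z"
    proof
      assume "fst y \<in> Z"
      then have "incident H (fst y) v"
        using y assms subgraph_incident[OF rg assms(2), of "fst y" v] by (auto simp: incident_rot[OF rg])
      then show False using that by (simp add: incident_iff)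
    qed
  qed
  ultimately show ?thesis by simp
qed

text \<open>For the last summand this is the single 1-sum read in the opposite order; for an earlier
  one, first cut \<open>Z\<close> down to \<open>K\<close>, where degrees are the same as in
  \<open>G\<close>.\<close>

lemma one_sum_seq_even_set:
  assumes "one_sum_seq G Hs"
  shows "\<Union> (edges ` set Hs) = edges G \<and>
    (\<forall>Z. even_set G Z \<longrightarrow> Z \<subseteq> edges G \<longrightarrow> (\<forall>H \<in> set Hs. even_set G (Z \<inter> edges H)))"
  using assms
proof induction
  case (single G)
  then show ?case by (auto simp: Int_absorb2)
next
  case (snoc K Hs G H)
  then obtain x where o: "one_sum_at G K H x" by (auto simp: one_sum_def)
  have rg: "ribbon_graph G" and K: "ribbon_subgraph K G" and H: "ribbon_subgraph H G"
    and un: "edges K \<union> edges H = edges G" and o': "one_sum_at G H K x"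
    using o by (auto simp: one_sum_at_def)
  have "even_set G (Z \<inter> edges H')" if Z: "even_set G Z" "Z \<subseteq> edges G" and H': "H' \<in> set (Hs @ [H])" for Z H'
  proof (cases "H' = H")
    case True
    then show ?thesis using one_sum_at_even_set[OF o'] Z by simp
  next
    case False
    then have "H' \<in> set Hs" using H' by auto
    then have "edges H' \<subseteq> edges K" using snoc.IH by auto
    have "even_set K (Z \<inter> edges K)"
      using one_sum_at_even_set[OF o Z] deg_subgraph[OF rg K, of "Z \<inter> edges K"] by (simp add: even_set_def)
    then have "even_set K (Z \<inter> edges K \<inter> edges H')" using snoc.IH \<open>H' \<in> set Hs\<close> by blast
    moreover have "Z \<inter> edges K \<inter> edges H' = Z \<inter> edges H'" using \<open>edges H' \<subseteq> edges K\<close> by auto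
    ultimately show ?thesis
      using deg_subgraph[OF rg K, of "Z \<inter> edges H'"] \<open>edges H' \<subseteq> edges K\<close>
      by (simp add: even_set_def Int_lower2 le_infI2)
  qed
  then show ?case using snoc.IH un by auto
qed

lemma biseparation_cycle:
  assumes rg: "ribbon_graph G" and A: "biseparation G A" and Z: "cycle_at G u Z"
  shows "Z \<subseteq> A \<or> Z \<subseteq> edges G - A"
proof -
  have ZG: "Z \<subseteq> edges G" and AG: "A \<subseteq> edges G" using A Z by (auto simp: biseparation_def cycle_at_def)
  show ?thesis
  proof (cases "A = {} \<or> A = edges G")
    case False
    let ?CA = "components_rg (edge_restriction G A)" and ?CB = "components_rg (edge_restriction G (edges G - A))"
    obtain Hs where Hs: "set Hs = ?CA \<union> ?CB" "one_sum_seq G Hs"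
      using A False unfolding biseparation_def Let_def by blast
    have "edges H \<subseteq> A \<or> edges H \<subseteq> edges G - A" if "H \<in> set Hs" for H
      using that Hs(1) by (auto simp: components_rg_def component_of_def edge_restriction_def restrict_def Let_def)
    moreover have "Z \<noteq> {}" using Z by (auto simp: cycle_at_def)
    then obtain H where H: "H \<in> set Hs" "Z \<inter> edges H \<noteq> {}"
      using one_sum_seq_even_set[OF Hs(2)] ZG
      by (metis (no_types, lifting) UN_iff disjoint_iff equals0I subsetD)
    moreover have "even_set G (Z \<inter> edges H)"
      using one_sum_seq_even_set[OF Hs(2)] cycle_at_even[OF Z] ZG H(1) by blast
    then have "Z \<inter> edges H = Z" using Z H(2) unfolding cycle_at_def by blast
    ultimately show ?thesis by blast
  qed (use ZG in auto)
qed

subsection \<open>Face sets and their boundaries\<close>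

text \<open>A union of boundary components of the surface, given by the corners on it.\<close>

definition face_set :: "('v, 'e) ribbon_graph \<Rightarrow> ('v segment \<times> bool) set \<Rightarrow> bool" where
  "face_set G X \<longleftrightarrow> X \<subseteq> corners G \<and>
     (\<forall>(c, d) \<in> vertex_arcs G \<union> edge_sides G. c \<in> X \<longleftrightarrow> d \<in> X)"

text \<open>The mod 2 boundary of the discs glued to these components: an edge belongs to it iff
  exactly one of its two sides is covered.\<close>

definition bd :: "('v, 'e) ribbon_graph \<Rightarrow> ('v segment \<times> bool) set \<Rightarrow> 'e set" where
  "bd G X = {e \<in> edges G. \<exists>s \<in> segments G. seg_edge G s = e \<and> ((s, False) \<in> X) \<noteq> ((s, True) \<in> X)}"

text \<open>A cycle is one-sided iff it has an odd number of twisted edges.\<close>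

definition twisted :: "('v, 'e) ribbon_graph \<Rightarrow> 'e \<Rightarrow> bool" where
  "twisted G e \<longleftrightarrow> (\<exists>v. (e, True) \<in> set (rot G v)) \<and> (\<exists>v. (e, False) \<in> set (rot G v))"

lemma segment_iff: "(v, i) \<in> segments G \<longleftrightarrow> v \<in> verts G \<and> i < length (rot G v)"
  by (simp add: segments_def)

lemma face_set_arc:
  assumes "face_set G X" "(v, i) \<in> segments G"
  shows "((v, i), True) \<in> X \<longleftrightarrow> ((v, Suc i mod length (rot G v)), False) \<in> X"
proof -
  have "(((v, i), True), ((v, Suc i mod length (rot G v)), False)) \<in> vertex_arcs G"
    using assms(2) unfolding vertex_arcs_def by blast
  then show ?thesis using assms(1) unfolding face_set_def by fast
qed

lemma face_set_side:
  assumes "face_set G X" "s \<in> segments G" "t \<in> segments G" "s \<noteq> t" "seg_edge G s = seg_edge G t"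
  shows "(s, seg_dir G s) \<in> X \<longleftrightarrow> (t, \<not> seg_dir G t) \<in> X"
proof -
  have "((s, seg_dir G s), (t, \<not> seg_dir G t)) \<in> edge_sides G"
    using assms unfolding edge_sides_def by blast
  then show ?thesis using assms(1) unfolding face_set_def by (auto dest!: bspec)
qed

lemma even_changes:
  fixes a :: "nat \<Rightarrow> bool"
  shows "even (card {i. i < m \<and> a i \<noteq> a (Suc i)}) \<longleftrightarrow> a 0 = a m"
proof (induction m)
  case (Suc m)
  have "{i. i < Suc m \<and> a i \<noteq> a (Suc i)} =
      (if a m \<noteq> a (Suc m) then insert m {i. i < m \<and> a i \<noteq> a (Suc i)} else {i. i < m \<and> a i \<noteq> a (Suc i)})"
    by (auto simp: less_Suc_eq)
  then show ?case using Suc by auto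
qed simp

lemma even_cyclic_changes:
  fixes a :: "nat \<Rightarrow> bool"
  shows "even (card {i. i < n \<and> a i \<noteq> a (Suc i mod n)})"
proof (cases n)
  case (Suc m)
  have "{i. i < n \<and> a i \<noteq> a (Suc i mod n)} =
      (if a m \<noteq> a 0 then insert m {i. i < m \<and> a i \<noteq> a (Suc i)} else {i. i < m \<and> a i \<noteq> a (Suc i)})"
    using Suc by (auto simp: less_Suc_eq mod_Suc)
  then show ?thesis using even_changes[of m a] by auto
qed simp

context
  fixes G :: "('v, 'e) ribbon_graph"
  assumes rg: "ribbon_graph G"
begin

lemma seg_edge_edges: "s \<in> segments G \<Longrightarrow> seg_edge G s \<in> edges G"
  using rg unfolding ribbon_graph_def by blast

lemma edge_segments:
  assumes "e \<in> edges G"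
  obtains s t where "s \<noteq> t" "{s' \<in> segments G. seg_edge G s' = e} = {s, t}"
proof -
  have "card {s' \<in> segments G. seg_edge G s' = e} = 2"
    using rg assms unfolding ribbon_graph_def by blast
  then show thesis unfolding card_2_iff using that by (elim exE conjE) simp
qed

lemma incident_segment: "incident G e v \<Longrightarrow> \<exists>i. (v, i) \<in> segments G \<and> seg_edge G (v, i) = e"
  unfolding incident_def by (metis prod.collapse)

text \<open>The two sides of an edge pair the ends of one of its segments with the ends of the
  other, so either segment decides whether exactly one side is covered.\<close>

lemma bd_iff:
  assumes X: "face_set G X" and s: "s \<in> segments G"
  shows "seg_edge G s \<in> bd G X \<longleftrightarrow> ((s, False) \<in> X) \<noteq> ((s, True) \<in> X)"
proof -
  have "((t, False) \<in> X) \<noteq> ((t, True) \<in> X) \<longleftrightarrow> ((s, False) \<in> X) \<noteq> ((s, True) \<in> X)"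
    if t: "t \<in> segments G" "seg_edge G t = seg_edge G s" for t
  proof (cases "s = t")
    case False
    then show ?thesis using face_set_side[OF X s t(1)] face_set_side[OF X t(1) s] t(2)
      by (cases "seg_dir G s"; cases "seg_dir G t") auto
  qed simp
  then show ?thesis unfolding bd_def using s seg_edge_edges[OF s] by blast
qed

text \<open>The basic move round a vertex: vertex arcs preserve membership in \<open>X\<close>, and
  passing a segment changes it only if its edge is in \<open>bd G X\<close>.\<close>

lemma face_set_walk:
  assumes X: "face_set G X" and "i < j" "j < length (rot G v)"
    and "\<And>k. i < k \<Longrightarrow> k < j \<Longrightarrow> fst (rot G v ! k) \<notin> bd G X"
  shows "((v, i), True) \<in> X \<longleftrightarrow> ((v, j), False) \<in> X"
proof -
  have v: "v \<in> verts G" using assms(3) rot_outside[OF rg] by (cases "v \<in> verts G") auto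
  have step: "((v, k), True) \<in> X \<longleftrightarrow> ((v, Suc k), False) \<in> X" if "Suc k < length (rot G v)" for k
    using face_set_arc[OF X, of v k] that v by (simp add: segment_iff)
  have "Suc i + m < length (rot G v) \<Longrightarrow> (\<And>k. i < k \<Longrightarrow> k < Suc i + m \<Longrightarrow> fst (rot G v ! k) \<notin> bd G X) \<Longrightarrow>
      ((v, i), True) \<in> X \<longleftrightarrow> ((v, Suc i + m), False) \<in> X" for m
  proof (induction m)
    case 0
    then show ?case using step[of i] by simp
  next
    case (Suc m)
    have "((v, i), True) \<in> X \<longleftrightarrow> ((v, Suc i + m), False) \<in> X" using Suc by auto
    also have "\<dots> \<longleftrightarrow> ((v, Suc i + m), True) \<in> X"
      using bd_iff[OF X, of "(v, Suc i + m)"] Suc.prems v by (auto simp: segment_iff seg_edge_def)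
    also have "\<dots> \<longleftrightarrow> ((v, Suc i + Suc m), False) \<in> X" using step Suc.prems by simp
    finally show ?case .
  qed
  from this[of "j - Suc i"] show ?thesis using assms by auto
qed

lemma face_set_constant:
  assumes X: "face_set G X" and d: "deg G (bd G X) v = 0"
    and ij: "i < length (rot G v)" "j < length (rot G v)"
  shows "((v, i), b) \<in> X \<longleftrightarrow> ((v, j), b') \<in> X"
proof -
  have v: "v \<in> verts G" using ij rot_outside[OF rg] by (cases "v \<in> verts G") auto
  have nb: "fst (rot G v ! k) \<notin> bd G X" if "k < length (rot G v)" for k
    using d that by (auto simp: deg_eq_0_iff)
  have 1: "((v, k), b1) \<in> X \<longleftrightarrow> ((v, k), b2) \<in> X" if "k < length (rot G v)" for k b1 b2
    using bd_iff[OF X, of "(v, k)"] nb[OF that] v that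
    by (cases b1; cases b2) (auto simp: segment_iff seg_edge_def)
  have "((v, k), True) \<in> X \<longleftrightarrow> ((v, l), False) \<in> X" if "k < l" "l < length (rot G v)" for k l
    using face_set_walk[OF X that] nb that by auto
  then show ?thesis using 1 ij by (metis linorder_neqE_nat)
qed

text \<open>Once round \<open>v\<close>, membership in \<open>X\<close> changes exactly at the
  segments of \<open>bd G X\<close>, and a cyclic sequence of truth values changes an even number of
  times.\<close>

lemma even_set_bd:
  assumes X: "face_set G X"
  shows "even_set G (bd G X)"
  unfolding even_set_def
proof
  fix v
  show "even (deg G (bd G X) v)"
  proof (cases "v \<in> verts G")
    case True
    let ?n = "length (rot G v)" and ?a = "\<lambda>i. ((v, i), False) \<in> X"
    have "fst (rot G v ! i) \<in> bd G X \<longleftrightarrow> ?a i \<noteq> ?a (Suc i mod ?n)" if "i < ?n" for i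
      using bd_iff[OF X, of "(v, i)"] face_set_arc[OF X, of v i] True that
      by (simp add: segment_iff seg_edge_def)
    then have "{i. i < ?n \<and> fst (rot G v ! i) \<in> bd G X} = {i. i < ?n \<and> ?a i \<noteq> ?a (Suc i mod ?n)}"
      by auto
    then show ?thesis unfolding deg_card using even_cyclic_changes[of ?n ?a] by simp
  qed (simp add: deg_outside[OF rg])
qed

lemma face_set_sym_diff: "face_set G X \<Longrightarrow> face_set G Y \<Longrightarrow> face_set G (sym_diff X Y)"
  unfolding face_set_def by (auto split: prod.splits)

lemma bd_sym_diff:
  assumes "face_set G X" "face_set G Y"
  shows "bd G (sym_diff X Y) = sym_diff (bd G X) (bd G Y)"
proof (rule set_eqI)
  fix e
  show "e \<in> bd G (sym_diff X Y) \<longleftrightarrow> e \<in> sym_diff (bd G X) (bd G Y)"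
  proof (cases "e \<in> edges G")
    case True
    then obtain s where "s \<in> segments G" "seg_edge G s = e" using edge_segments by blast
    then show ?thesis
      using bd_iff[OF face_set_sym_diff[OF assms], of s] bd_iff[OF assms(1), of s] bd_iff[OF assms(2), of s]
      by auto
  qed (auto simp: bd_def)
qed

text \<open>With no boundary, membership in \<open>X\<close> is constant round each vertex and
  carries over along each edge, so connectedness leaves all or nothing: a connected closed surface
  has a single nonzero mod 2 cycle in dimension two.\<close>

lemma bd_empty_cases:
  assumes conn: "connected_rg G" and X: "face_set G X" and bd: "bd G X = {}"
  shows "X = {} \<or> X = corners G"
proof (rule disjCI)
  assume "X \<noteq> corners G"
  show "X = {}"
  proof (rule ccontr)
    assume "X \<noteq> {}"
    then obtain v0 i0 b0 where c: "((v0, i0), b0) \<in> X" by fastforce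
    then have seg: "(v0, i0) \<in> segments G" using X by (auto simp: face_set_def corners_def)
    have const: "((v, i), b) \<in> X \<longleftrightarrow> ((v, j), b') \<in> X"
      if "i < length (rot G v)" "j < length (rot G v)" for v i j b b'
      using face_set_constant[OF X _ that] bd by simp
    have all: "\<forall>i < length (rot G w). \<forall>b. ((w, i), b) \<in> X" if "(v0, w) \<in> (adjacency G)\<^sup>*" for w
      using that
    proof (induction rule: rtrancl_induct)
      case base
      then show ?case using const c seg by (metis segment_iff)
    next
      case (step y z)
      then obtain e where "incident G e y" "incident G e z" by (auto simp: adjacency_def)
      then obtain i j where ij: "(y, i) \<in> segments G" "(z, j) \<in> segments G"
        "seg_edge G (y, i) = seg_edge G (z, j)" using incident_segment by metis
      have "\<exists>b. ((z, j), b) \<in> X"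
      proof (cases "(y, i) = (z, j)")
        case False
        then show ?thesis using face_set_side[OF X ij(1,2) _ ij(3)] step(3) ij(1) by (auto simp: segment_iff)
      qed (use step(3) ij in \<open>auto simp: segment_iff\<close>)
      then show ?case using const ij(2) by (metis segment_iff)
    qed
    have "corners G \<subseteq> X"
    proof
      fix c assume "c \<in> corners G"
      then obtain w i b where w: "c = ((w, i), b)" "(w, i) \<in> segments G" by (auto simp: corners_def)
      then have "(v0, w) \<in> (adjacency G)\<^sup>*" using conn seg by (auto simp: connected_rg_def segment_iff)
      then show "c \<in> X" using all w by (auto simp: segment_iff)
    qed
    then show False using X \<open>X \<noteq> corners G\<close> by (auto simp: face_set_def)
  qed
qed

lemma finite_corners: "finite (corners G)"
  using finite_segments[OF finite_verts[OF rg]] by (simp add: corners_def)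

lemma finite_face_sets: "finite {X. face_set G X}"
  by (rule finite_subset[of _ "Pow (corners G)"]) (auto simp: face_set_def finite_corners)

text \<open>Any set of boundary components has a face set as its union, and classes being disjoint
  and nonempty, different sets have different unions.\<close>

lemma card_face_sets: "2 ^ card (corners G // boundary_rel G) \<le> card {X. face_set G X}"
proof -
  let ?R = "boundary_rel G" and ?S = "vertex_arcs G \<union> (vertex_arcs G)\<inverse> \<union> edge_sides G \<union> (edge_sides G)\<inverse>"
  have "sym ?S" by (auto simp: sym_def)
  then have "sym ?R" unfolding boundary_rel_def by (rule sym_rtrancl)
  then have eq: "equiv UNIV ?R"
    unfolding boundary_rel_def equiv_def by (simp add: refl_rtrancl trans_rtrancl)
  have arcs: "vertex_arcs G \<union> edge_sides G \<subseteq> corners G \<times> corners G"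
    unfolding vertex_arcs_def edge_sides_def corners_def segments_def
    by (auto intro!: mod_less_divisor)
  have "d \<in> corners G" if "(c, d) \<in> ?R" "c \<in> corners G" for c d
    using that unfolding boundary_rel_def
  proof (induction rule: rtrancl_induct)
    case (step y z)
    then show ?case using arcs by auto
  qed
  then have sub: "\<Union>F \<subseteq> corners G" if "F \<subseteq> corners G // ?R" for F
    using that by (fastforce simp: quotient_def)
  have Q: "corners G // ?R \<subseteq> UNIV // ?R" by (auto simp: quotient_def)
  have fs: "face_set G (\<Union>F)" if F: "F \<subseteq> corners G // ?R" for F
    unfolding face_set_def
  proof (intro conjI ballI)
    show "\<Union>F \<subseteq> corners G" by (rule sub[OF F])
    fix p assume "p \<in> vertex_arcs G \<union> edge_sides G"
    moreover obtain c d where p: "p = (c, d)" by (rule prod.exhaust)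
    ultimately have cd: "(c, d) \<in> ?R" unfolding boundary_rel_def by auto
    have "c \<in> K \<longleftrightarrow> d \<in> K" if "K \<in> F" for K
      using in_quotient_imp_closed[OF eq, of K] that F Q cd \<open>sym ?R\<close> by (meson subsetD symD)
    then show "case p of (c, d) \<Rightarrow> (c \<in> \<Union>F) = (d \<in> \<Union>F)" using p by auto
  qed
  have "inj_on Union (Pow (corners G // ?R))"
  proof (rule inj_onI)
    have "F \<subseteq> F'" if FF: "F \<in> Pow (corners G // ?R)" "F' \<in> Pow (corners G // ?R)" "\<Union>F \<subseteq> \<Union>F'" for F F'
    proof
      fix K assume K: "K \<in> F"
      then have "K \<in> UNIV // ?R" using FF Q by auto
      then obtain c where c: "c \<in> K" using in_quotient_imp_non_empty[OF eq] by blast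
      then obtain K' where "K' \<in> F'" "c \<in> K'" using K FF(3) by blast
      moreover from this have "K' \<in> UNIV // ?R" using FF(2) Q by auto
      ultimately show "K \<in> F'" using quotient_disj[OF eq \<open>K \<in> UNIV // ?R\<close>] c by blast
    qed
    then show "F = F'" if "F \<in> Pow (corners G // ?R)" "F' \<in> Pow (corners G // ?R)" "\<Union>F = \<Union>F'" for F F'
      using that by (metis subset_antisym order_refl)
  qed
  then have "card (Pow (corners G // ?R)) \<le> card {X. face_set G X}"
    by (rule card_inj_on_le) (use fs finite_face_sets in auto)
  moreover have "finite (corners G // ?R)"
    using finite_corners by (simp add: quotient_def)
  ultimately show ?thesis by (simp add: card_Pow)
qed

section \<open>Dimension count: mod 2 cycles against boundaries\<close>

definition boundaries :: "'e set set" where "boundaries = bd G ` {X. face_set G X}"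

text \<open>Two face sets with the same boundary differ by one without boundary, hence are equal or
  complementary: the fibres of \<open>bd\<close> have at most two elements.\<close>

lemma card_boundaries:
  assumes conn: "connected_rg G"
  shows "2 ^ card (corners G // boundary_rel G) \<le> 2 * card boundaries"
proof -
  let ?K = "{X. face_set G X}"
  have fib: "card {X \<in> ?K. bd G X = y} \<le> 2" if "y \<in> boundaries" for y
  proof -
    obtain X0 where X0: "face_set G X0" "bd G X0 = y" using \<open>y \<in> boundaries\<close> by (auto simp: boundaries_def)
    have "X = X0 \<or> X = corners G - X0" if X: "face_set G X" "bd G X = y" for X
    proof -
      have "bd G (sym_diff X X0) = {}" using bd_sym_diff[OF X(1) X0(1)] X X0 by simp
      then have "sym_diff X X0 = {} \<or> sym_diff X X0 = corners G"
        by (rule bd_empty_cases[OF conn face_set_sym_diff[OF X(1) X0(1)]])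
      then show ?thesis using X X0 unfolding face_set_def by blast
    qed
    then have "{X \<in> ?K. bd G X = y} \<subseteq> {X0, corners G - X0}" by auto
    then have "card {X \<in> ?K. bd G X = y} \<le> card {X0, corners G - X0}" by (intro card_mono) auto
    also have "\<dots> \<le> 2" by (simp add: card_insert_if)
    finally show ?thesis .
  qed
  have "card ?K = (\<Sum>y \<in> boundaries. card {X \<in> ?K. bd G X = y})"
    using sum.image_gen[OF finite_face_sets, of "\<lambda>_. 1::nat" "bd G"] by (simp add: boundaries_def)
  also have "\<dots> \<le> (\<Sum>y \<in> boundaries. 2)" using fib by (intro sum_mono)
  finally show ?thesis using card_face_sets by simp
qed

text \<open>Modulo \<open>boundaries\<close> this is the first homology, over the two-element field,
  of the surface with discs glued in. For connected \<open>G\<close> with an edge its dimension is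
  the Euler genus.\<close>

definition cycle_space :: "'e set set" where "cycle_space = {Z. Z \<subseteq> edges G \<and> even_set G Z}"

lemma boundaries_cycle_space: "boundaries \<subseteq> cycle_space"
  unfolding boundaries_def cycle_space_def using even_set_bd by (auto simp: bd_def)

lemma finite_cycle_space: "finite cycle_space"
  by (rule finite_subset[of _ "Pow (edges G)"]) (auto simp: cycle_space_def finite_edges[OF rg])

text \<open>Add up mod 2 a walk from \<open>r\<close> to each vertex of \<open>W\<close>. The parity
  at \<open>r\<close> is left open, as the handshake identity determines it.\<close>

lemma odd_vertex_sets:
  assumes conn: "connected_rg G" and r: "r \<in> verts G" and W: "W \<subseteq> verts G - {r}"
  shows "\<exists>J. J \<subseteq> edges G \<and> (\<forall>w. w \<noteq> r \<longrightarrow> (odd (deg G J w) \<longleftrightarrow> w \<in> W))"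
proof -
  have single: "\<exists>J. J \<subseteq> edges G \<and> (\<forall>w. w \<noteq> r \<longrightarrow> (odd (deg G J w) \<longleftrightarrow> w = v))"
    if "(r, v) \<in> (adjacency G)\<^sup>*" for v
    using that
  proof (induction rule: rtrancl_induct)
    case base
    then show ?case by (intro exI[of _ "{}"]) auto
  next
    case (step y z)
    then obtain e where e: "incident G e y" "incident G e z" by (auto simp: adjacency_def)
    obtain J where J: "J \<subseteq> edges G" "\<And>w. w \<noteq> r \<Longrightarrow> odd (deg G J w) \<longleftrightarrow> w = y" using step.IH by blast
    show ?case
    proof (cases "y = z")
      case False
      have "odd (deg G (sym_diff J {e}) w) \<longleftrightarrow> w = z" if "w \<noteq> r" for w
        using edge_two_ends[OF rg e False] J(2)[OF that] deg_sym_diff[of G J "{e}" w] False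
        by (cases "w = y"; cases "w = z") auto
      moreover have "sym_diff J {e} \<subseteq> edges G" using J(1) incident_edges[OF rg e(1)] by blast
      ultimately show ?thesis by blast
    qed (use J in blast)
  qed
  have "finite W" using W finite_verts[OF rg] finite_subset by blast
  then show ?thesis using W
  proof (induction W rule: finite_induct)
    case empty
    then show ?case by (intro exI[of _ "{}"]) auto
  next
    case (insert x W)
    obtain J where J: "J \<subseteq> edges G" "\<And>w. w \<noteq> r \<Longrightarrow> odd (deg G J w) \<longleftrightarrow> w \<in> W" using insert by blast
    have "(r, x) \<in> (adjacency G)\<^sup>*" using conn r insert.prems by (auto simp: connected_rg_def)
    then obtain J' where J': "J' \<subseteq> edges G" "\<And>w. w \<noteq> r \<Longrightarrow> odd (deg G J' w) \<longleftrightarrow> w = x" using single by blast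
    have "odd (deg G (sym_diff J J') w) \<longleftrightarrow> w \<in> insert x W" if "w \<noteq> r" for w
      using J(2)[OF that] J'(2)[OF that] insert.hyps(2) deg_sym_diff[of G J J' w] by auto
    moreover have "sym_diff J J' \<subseteq> edges G" using J(1) J'(1) by blast
    ultimately show ?case by blast
  qed
qed

text \<open>Rank and nullity as an injection: \<open>J\<close> chooses an edge set for each
  prescribed set of odd vertices, and an edge set of the form \<open>sym_diff Z (J W)\<close>
  reveals \<open>W\<close> by its odd vertices and then \<open>Z\<close>.\<close>

lemma card_cycle_space:
  assumes conn: "connected_rg G"
  shows "card cycle_space * 2 ^ (card (verts G) - 1) \<le> 2 ^ card (edges G)"
proof -
  obtain r where r: "r \<in> verts G" using conn by (auto simp: connected_rg_def)
  define J where "J W = (SOME J. J \<subseteq> edges G \<and> (\<forall>w. w \<noteq> r \<longrightarrow> (odd (deg G J w) \<longleftrightarrow> w \<in> W)))" for W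
  have J: "J W \<subseteq> edges G \<and> (\<forall>w. w \<noteq> r \<longrightarrow> (odd (deg G (J W) w) \<longleftrightarrow> w \<in> W))"
    if "W \<subseteq> verts G - {r}" for W
    unfolding J_def by (rule someI_ex[OF odd_vertex_sets[OF conn r that]])
  note J = J[THEN conjunct1] J[THEN conjunct2, rule_format]
  let ?f = "\<lambda>(Z, W). sym_diff Z (J W)"
  have odd: "odd (deg G (sym_diff Z (J W)) w) \<longleftrightarrow> w \<in> W"
    if "Z \<in> cycle_space" "W \<subseteq> verts G - {r}" "w \<noteq> r" for Z W w
    using that J(2)[OF that(2,3)] deg_sym_diff[of G Z "J W" w] by (auto simp: cycle_space_def even_set_def)
  have "inj_on ?f (cycle_space \<times> Pow (verts G - {r}))"
  proof (rule inj_onI, clarify)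
    fix Z W Z' W' assume a: "Z \<in> cycle_space" "W \<subseteq> verts G - {r}" "Z' \<in> cycle_space" "W' \<subseteq> verts G - {r}"
      and e: "sym_diff Z (J W) = sym_diff Z' (J W')"
    have "w \<in> W \<longleftrightarrow> w \<in> W'" for w
      using odd[OF a(1,2), of w] odd[OF a(3,4), of w] a(2,4) e by (cases "w = r") auto
    then have "W = W'" by blast
    then show "Z = Z' \<and> W = W'" using e by blast
  qed
  then have "card (cycle_space \<times> Pow (verts G - {r})) \<le> card (Pow (edges G))"
    by (rule card_inj_on_le) (use J(1) finite_edges[OF rg] in \<open>auto simp: cycle_space_def\<close>)
  then show ?thesis using r finite_verts[OF rg] finite_edges[OF rg] by (simp add: card_cartesian_product card_Pow)
qed

text \<open>Both branches of \<open>genus\<close> give 2 minus the Euler characteristic, and a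
  connected ribbon graph with an edge has no isolated vertex to contribute an extra boundary
  circle.\<close>

lemma euler_genus_connected:
  assumes conn: "connected_rg G" and E: "edges G \<noteq> {}"
  shows "euler_genus G = 2 - (real (card (verts G)) - real (card (edges G)) + real (card (corners G // boundary_rel G)))"
proof -
  have "component_of G u = G" if "u \<in> verts G" for u
  proof -
    have W: "{w \<in> verts G. (u, w) \<in> (adjacency G)\<^sup>*} = verts G"
      using conn that by (auto simp: connected_rg_def)
    have "{e \<in> edges G. \<exists>w \<in> verts G. incident G e w} = edges G"
      using edge_incident[OF rg] incident_iff[of G] by blast
    then show ?thesis unfolding component_of_def Let_def W using restrict_self[OF rg] by simp
  qed
  then have comps: "components_rg G = {G}" using conn by (auto simp: components_rg_def connected_rg_def image_iff)
  have "rot G v \<noteq> []" if v: "v \<in> verts G" for v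
  proof
    assume "rot G v = []"
    then have "\<not> incident G e v" for e by (simp add: incident_iff)
    then have "(v, w) \<notin> adjacency G" for w by (auto simp: adjacency_def)
    then have "w = v" if "w \<in> verts G" for w
      using conn v that unfolding connected_rg_def by (metis converse_rtranclE)
    moreover obtain e w where "incident G e w" using E edge_incident[OF rg] by blast
    ultimately show False using \<open>\<And>e. \<not> incident G e v\<close> by (metis incident_iff)
  qed
  then have "{v \<in> verts G. rot G v = []} = {}" by blast
  then have "num_boundary_components G = card (corners G // boundary_rel G)"
    by (simp only: num_boundary_components_def card.empty add_0_right)
  then show ?thesis unfolding euler_genus_def comps genus_def closed_euler_char_def by simp
qed

text \<open>Euler's formula turns the upper bound 2^(E-V+1) on cycles into 2^(F-1), which is the
  lower bound on boundaries.\<close>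

lemma plane_cycle_space:
  assumes "plane_rg G" "edges G \<noteq> {}"
  shows "cycle_space = boundaries"
proof -
  have conn: "connected_rg G" using assms by (simp add: plane_rg_def)
  let ?V = "card (verts G)" and ?E = "card (edges G)" and ?F = "card (corners G // boundary_rel G)"
  have "real ?V + real ?F = real ?E + 2"
    using assms euler_genus_connected[OF conn] by (simp add: plane_rg_def)
  then have VEF: "?V + ?F = ?E + 2" by linarith
  have "?V > 0" using conn finite_verts[OF rg] by (auto simp: connected_rg_def card_gt_0_iff)
  \<comment> \<open>Needed for the truncated subtraction \<open>?F - 1\<close>. With
    \<open>?F = 0\<close> there would be two more vertices than edges, against the bound on the
    cycle space.\<close>
  moreover have "?F \<noteq> 0"
  proof
    assume "?F = 0"
    have "{} \<in> cycle_space" by (simp add: cycle_space_def even_set_def)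
    then have "card cycle_space > 0" using finite_cycle_space card_gt_0_iff by blast
    then have "card cycle_space \<ge> 1" by linarith
    then have "2 ^ (?V - 1) \<le> (2::nat) ^ ?E"
      using card_cycle_space[OF conn] by (metis le_trans mult_le_mono1 nat_mult_1)
    then show False using VEF \<open>?F = 0\<close> by simp
  qed
  ultimately have E: "?E = (?V - 1) + (?F - 1)" using VEF by linarith
  have "card cycle_space * 2 ^ (?V - 1) \<le> 2 ^ (?F - 1) * 2 ^ (?V - 1)"
    using card_cycle_space[OF conn] unfolding E by (simp add: power_add mult.commute)
  then have "card cycle_space \<le> 2 ^ (?F - 1)" by simp
  moreover have "2 * 2 ^ (?F - 1) \<le> 2 * card boundaries"
    using card_boundaries[OF conn] \<open>?F \<noteq> 0\<close> by (metis power_eq_if)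
  ultimately have "card cycle_space \<le> card boundaries" by simp
  then show ?thesis using card_seteq[OF finite_cycle_space boundaries_cycle_space] by simp
qed

text \<open>Now the same count allows index two: the boundaries and their coset of \<open>Z\<close>
  are disjoint and of equal size, so they exhaust the cycle space, and \<open>Z'\<close> lies in
  that coset.\<close>

lemma rp2_cycle_space:
  assumes "rp2_rg G" "edges G \<noteq> {}"
    and Z: "Z \<in> cycle_space" "Z \<notin> boundaries" "Z' \<in> cycle_space" "Z' \<notin> boundaries"
  shows "sym_diff Z Z' \<in> boundaries"
proof -
  have conn: "connected_rg G" using assms by (simp add: rp2_rg_def)
  let ?V = "card (verts G)" and ?E = "card (edges G)" and ?F = "card (corners G // boundary_rel G)"
  have "real ?V + real ?F = real ?E + 1"
    using assms euler_genus_connected[OF conn] by (simp add: rp2_rg_def)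
  then have VEF: "?V + ?F = ?E + 1" by linarith
  have "?V > 0" using conn finite_verts[OF rg] by (auto simp: connected_rg_def card_gt_0_iff)
  then have E: "?E = (?V - 1) + ?F" using VEF by linarith
  have "card cycle_space * 2 ^ (?V - 1) \<le> 2 ^ ?F * 2 ^ (?V - 1)"
    using card_cycle_space[OF conn] unfolding E by (simp add: power_add mult.commute)
  then have "card cycle_space \<le> 2 ^ ?F" by simp
  then have le: "card cycle_space \<le> 2 * card boundaries" using card_boundaries[OF conn] by linarith
  have bd_closed: "sym_diff Y Y' \<in> boundaries" if YY: "Y \<in> boundaries" "Y' \<in> boundaries" for Y Y'
  proof -
    obtain X X' where X: "face_set G X" "Y = bd G X" "face_set G X'" "Y' = bd G X'"
      using YY unfolding boundaries_def by blast
    then have "sym_diff Y Y' = bd G (sym_diff X X')" using bd_sym_diff by simp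
    then show ?thesis unfolding boundaries_def using face_set_sym_diff[OF X(1,3)] by blast
  qed
  let ?T = "(\<lambda>Y. sym_diff Z Y) ` boundaries"
  have inv: "sym_diff Z (sym_diff Z Y) = Y" for Y by blast
  have "inj_on (\<lambda>Y. sym_diff Z Y) boundaries" by (rule inj_on_inverseI[of _ "\<lambda>Y. sym_diff Z Y"]) (rule inv)
  then have cT: "card ?T = card boundaries" by (rule card_image)
  have fin: "finite boundaries" using finite_cycle_space boundaries_cycle_space finite_subset by blast
  have "boundaries \<inter> ?T = {}"
  proof (rule ccontr)
    assume "boundaries \<inter> ?T \<noteq> {}"
    then obtain Y where "Y \<in> boundaries" "sym_diff Z Y \<in> boundaries" by blast
    then have "sym_diff (sym_diff Z Y) Y \<in> boundaries" using bd_closed by blast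
    moreover have "sym_diff (sym_diff Z Y) Y = Z" by blast
    ultimately show False using Z by simp
  qed
  then have "card (boundaries \<union> ?T) = 2 * card boundaries" using fin cT by (simp add: card_Un_disjoint)
  moreover have "boundaries \<union> ?T \<subseteq> cycle_space"
  proof -
    have "sym_diff Z Y \<in> cycle_space" if "Y \<in> cycle_space" for Y
      using Z(1) that deg_sym_diff[of G Z Y] unfolding cycle_space_def even_set_def by auto
    then show ?thesis using boundaries_cycle_space by blast
  qed
  ultimately have "boundaries \<union> ?T = cycle_space"
    using card_seteq[OF finite_cycle_space] le by metis
  then obtain Y where "Y \<in> boundaries" "Z' = sym_diff Z Y" using Z by blast
  then show ?thesis using inv[of Y] by simp
qed


text \<open>Walking along \<open>Z\<close> never changes the side of the boundary \<open>bd G X\<close>, but its two ends at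
  \<open>u\<close> are separated by exactly one segment of that boundary.\<close>

lemma crossing_not_boundary:
  assumes X: "face_set G X" and Z: "Z \<subseteq> edges G" "even_set G Z" "Z \<inter> bd G X = {}"
    and away: "\<And>v. v \<noteq> u \<Longrightarrow> deg G Z v > 0 \<Longrightarrow> deg G (bd G X) v = 0"
    and u: "b < c" "c < d" "d < length (rot G u)"
    and Zu: "{i. i < length (rot G u) \<and> fst (rot G u ! i) \<in> Z} = {b, d}"
    and c: "fst (rot G u ! c) \<in> bd G X"
    and only_c: "\<And>i. b < i \<Longrightarrow> i < d \<Longrightarrow> fst (rot G u ! i) \<in> bd G X \<Longrightarrow> i = c"
  shows False
proof -
  \<comment> \<open>The edges of \<open>Z\<close> inside the region \<open>X\<close>. As
    \<open>Z\<close> avoids \<open>bd G X\<close>, an edge has all or none of its corners in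
    \<open>X\<close>, and either segment decides.\<close>
  define T where "T = {f \<in> Z. \<exists>s \<in> segments G. seg_edge G s = f \<and> (s, True) \<in> X}"
  have uV: "u \<in> verts G" using u(3) rot_outside[OF rg] by (cases "u \<in> verts G") auto
  have T_iff: "seg_edge G s \<in> T \<longleftrightarrow> (s, True) \<in> X" if s: "s \<in> segments G" "seg_edge G s \<in> Z" for s
  proof -
    have "(t, True) \<in> X \<longleftrightarrow> (s, True) \<in> X" if t: "t \<in> segments G" "seg_edge G t = seg_edge G s" for t
    proof (cases "t = s")
      case False
      have "seg_edge G s \<notin> bd G X" using s(2) Z(3) by blast
      then show ?thesis
        using face_set_side[OF X t(1) s(1) False t(2)] bd_iff[OF X s(1)] bd_iff[OF X t(1)] t(2)
        by (cases "seg_dir G s"; cases "seg_dir G t") auto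
    qed simp
    then show ?thesis unfolding T_def using s by blast
  qed
  have "even (deg G T v)" if v: "v \<in> verts G" "v \<noteq> u" for v
  proof (cases "deg G Z v > 0")
    case False
    then show ?thesis using deg_mono[of T Z G v] by (auto simp: T_def)
  next
    case True
    note const = face_set_constant[OF X away[OF v(2) True]]
    have TZ: "fst (rot G v ! i) \<in> T \<longleftrightarrow> fst (rot G v ! i) \<in> Z \<and> ((v, i), True) \<in> X"
      if "i < length (rot G v)" for i
      using T_iff[of "(v, i)"] that v by (auto simp: segment_iff seg_edge_def T_def)
    show ?thesis
    proof (cases "\<exists>i < length (rot G v). ((v, i), True) \<in> X")
      case True
      then have "\<And>i. i < length (rot G v) \<Longrightarrow> ((v, i), True) \<in> X" using const by blast
      then have "deg G T v = deg G Z v" unfolding deg_card using TZ by (metis (no_types, lifting))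
      then show ?thesis using Z by (simp add: even_set_def)
    next
      case False
      then have "{i. i < length (rot G v) \<and> fst (rot G v ! i) \<in> T} = {}" using TZ by blast
      then show ?thesis unfolding deg_card by (simp only: card.empty even_zero)
    qed
  qed
  \<comment> \<open>At other vertices \<open>X\<close> is constant where \<open>Z\<close> passes, so
    \<open>T\<close> takes all or nothing of \<open>Z\<close> there. The forced parity at
    \<open>u\<close> puts \<open>b\<close> and \<open>d\<close> on the same side, whereas the walk
    from \<open>b\<close> to \<open>d\<close> changes sides once, at \<open>c\<close>.\<close>
  then have "even (deg G T u)" using even_set_except_vertex[OF rg, of u T] by (simp add: even_set_def)
  note ev = this
  have bd_in: "b < length (rot G u)" "fst (rot G u ! b) \<in> Z" "fst (rot G u ! d) \<in> Z" using Zu by blast+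
  have "{i. i < length (rot G u) \<and> fst (rot G u ! i) \<in> T} =
      {i \<in> {b, d}. fst (rot G u ! i) \<in> T}" using Zu by (auto simp: T_def)
  also have "\<dots> = (if fst (rot G u ! b) \<in> T then {b} else {}) \<union> (if fst (rot G u ! d) \<in> T then {d} else {})"
    by auto
  finally have "deg G T u = card ((if fst (rot G u ! b) \<in> T then {b} else {}) \<union> (if fst (rot G u ! d) \<in> T then {d} else {}))"
    by (simp add: deg_card)
  then have "fst (rot G u ! b) \<in> T \<longleftrightarrow> fst (rot G u ! d) \<in> T"
    using u ev by (auto split: if_splits)
  then have "((u, b), True) \<in> X \<longleftrightarrow> ((u, d), True) \<in> X"
    using T_iff[of "(u, b)"] T_iff[of "(u, d)"] bd_in u uV by (simp add: segment_iff seg_edge_def)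
  moreover have "((u, d), True) \<in> X \<longleftrightarrow> ((u, d), False) \<in> X"
    using bd_iff[OF X, of "(u, d)"] bd_in(3) Z(3) u uV by (auto simp: segment_iff seg_edge_def)
  moreover have "((u, b), True) \<in> X \<longleftrightarrow> ((u, c), False) \<in> X"
  proof (rule face_set_walk[OF X u(1)])
    fix k assume "b < k" "k < c"
    then show "fst (rot G u ! k) \<notin> bd G X" using only_c[of k] u(2) by auto
  qed (use u in simp)
  moreover have "((u, c), False) \<in> X \<longleftrightarrow> ((u, c), True) \<notin> X"
    using bd_iff[OF X, of "(u, c)"] c u uV by (auto simp: segment_iff seg_edge_def)
  moreover have "((u, c), True) \<in> X \<longleftrightarrow> ((u, d), False) \<in> X"
  proof (rule face_set_walk[OF X u(2,3)])
    fix k assume "c < k" "k < d"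
    then show "fst (rot G u ! k) \<notin> bd G X" using only_c[of k] u(1) by auto
  qed
  ultimately show False by blast
qed

text \<open>\<open>twisted\<close> is defined by the entries of rotations so that it passes to
  subgraphs without reindexing; this translates it into the two segments of the edge.\<close>

lemma twisted_iff:
  assumes "e \<in> edges G" "{s' \<in> segments G. seg_edge G s' = e} = {s, t}"
  shows "twisted G e \<longleftrightarrow> seg_dir G s \<noteq> seg_dir G t"
proof -
  have "(\<exists>v. (e, b) \<in> set (rot G v)) \<longleftrightarrow> (\<exists>s' \<in> {s, t}. seg_dir G s' = b)" for b
  proof
    assume "\<exists>v. (e, b) \<in> set (rot G v)"
    then obtain v i where "i < length (rot G v)" "rot G v ! i = (e, b)" by (metis in_set_conv_nth)
    moreover from this have "v \<in> verts G" using rot_outside[OF rg] by (cases "v \<in> verts G") auto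
    ultimately have "(v, i) \<in> {s' \<in> segments G. seg_edge G s' = e}" "seg_dir G (v, i) = b"
      by (auto simp: segment_iff seg_edge_def seg_dir_def)
    then show "\<exists>s' \<in> {s, t}. seg_dir G s' = b" using assms by blast
  next
    assume "\<exists>s' \<in> {s, t}. seg_dir G s' = b"
    then obtain s' where s': "s' \<in> segments G" "seg_edge G s' = e" "seg_dir G s' = b" using assms by blast
    then have "rot G (fst s') ! snd s' = (e, b)" "snd s' < length (rot G (fst s'))"
      by (auto simp: seg_edge_def seg_dir_def segments_def prod_eq_iff)
    then show "\<exists>v. (e, b) \<in> set (rot G v)" by (metis nth_mem)
  qed
  then show ?thesis unfolding twisted_def by auto
qed

text \<open>Count modulo 2, once by edges and once by vertices, the segments of \<open>Z\<close> whose last point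
  is in \<open>X\<close>: an edge contributes an odd number iff it is untwisted, a vertex other than \<open>u\<close> always
  contributes one, and \<open>Z\<close> has as many edges as vertices.\<close>

lemma twisted_parity:
  assumes X: "face_set G X" and Z: "Z \<subseteq> bd G X"
    and u: "a < c" and Zu: "{i. i < length (rot G u) \<and> fst (rot G u ! i) \<in> Z} = {a, c}"
    and away: "\<And>v. v \<noteq> u \<Longrightarrow> deg G Z v = 0 \<or> deg G Z v = 2 \<and> deg G (bd G X) v = 2"
  shows "even (card {e \<in> Z. twisted G e}) \<longleftrightarrow> (((u, a), True) \<in> X) \<noteq> (((u, c), True) \<in> X)"
proof -
  let ?E = "edges G" and ?V = "verts G"
  have ZE: "Z \<subseteq> ?E" using Z by (auto simp: bd_def)
  have finZ: "finite Z" using ZE finite_edges[OF rg] finite_subset by blast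
  define S where "S = {s \<in> segments G. seg_edge G s \<in> Z \<and> (s, True) \<in> X}"
  have finS: "finite S" using finite_segments[OF finite_verts[OF rg]] by (simp add: S_def)
  define ce where "ce e = card {s \<in> S. seg_edge G s = e}" for e
  define cv where "cv v = card {s \<in> S. fst s = v}" for v
  have "seg_edge G ` S \<subseteq> Z" by (auto simp: S_def)
  then have "card S = (\<Sum>e \<in> Z. ce e)"
    using sum.group[OF finS finZ, of "seg_edge G" "\<lambda>_. 1::nat"] by (simp add: ce_def)
  then have e1: "even (card S) \<longleftrightarrow> even (card {e \<in> Z. odd (ce e)})"
    by (simp add: even_sum_iff[OF finZ])
  \<comment> \<open>Exactly one side of \<open>e\<close> is covered. A side of an untwisted edge
    joins the last point of one segment to the first point of the other, so one last point is
    covered; in a twisted edge the two last points lie on the same side, so both or neither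
    are.\<close>
  have "odd (ce e) \<longleftrightarrow> \<not> twisted G e" if e: "e \<in> Z" for e
  proof -
    obtain s t where st: "s \<noteq> t" "{s' \<in> segments G. seg_edge G s' = e} = {s, t}"
      using edge_segments e ZE by blast
    then have seg: "s \<in> segments G" "t \<in> segments G" "seg_edge G s = e" "seg_edge G t = e" by blast+
    have "{s' \<in> S. seg_edge G s' = e} = {s' \<in> {s, t}. (s', True) \<in> X}"
      using e unfolding st(2)[symmetric] S_def by blast
    also have "\<dots> = (if (s, True) \<in> X then {s} else {}) \<union> (if (t, True) \<in> X then {t} else {})" by auto
    finally have "odd (ce e) \<longleftrightarrow> ((s, True) \<in> X) \<noteq> ((t, True) \<in> X)"
      unfolding ce_def using st(1) by simp
    also have "\<dots> \<longleftrightarrow> seg_dir G s = seg_dir G t"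
      using face_set_side[OF X seg(1,2) st(1)] bd_iff[OF X seg(1)] bd_iff[OF X seg(2)] seg Z e
      by (cases "seg_dir G s"; cases "seg_dir G t") auto
    finally show ?thesis using twisted_iff[OF _ st(2)] e ZE by auto
  qed
  then have "{e \<in> Z. odd (ce e)} = {e \<in> Z. \<not> twisted G e}" by blast
  then have by_edges: "even (card S) \<longleftrightarrow> even (card {e \<in> Z. \<not> twisted G e})" using e1 by simp
  have "fst ` S \<subseteq> ?V" by (auto simp: S_def segments_def)
  then have "card S = (\<Sum>v \<in> ?V. cv v)"
    using sum.group[OF finS finite_verts[OF rg], of fst "\<lambda>_. 1::nat"] by (simp add: cv_def)
  then have v1: "even (card S) \<longleftrightarrow> even (card {v \<in> ?V. odd (cv v)})"
    by (simp add: even_sum_iff[OF finite_verts[OF rg]])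
  have cv: "odd (cv v) \<longleftrightarrow> (((v, i), True) \<in> X) \<noteq> (((v, j), True) \<in> X)"
    if v: "v \<in> ?V" "i \<noteq> j" "{k. k < length (rot G v) \<and> fst (rot G v ! k) \<in> Z} = {i, j}" for v i j
  proof -
    have "{s \<in> S. fst s = v} = Pair v ` {k \<in> {k. k < length (rot G v) \<and> fst (rot G v ! k) \<in> Z}. ((v, k), True) \<in> X}"
      using v(1) by (auto simp: S_def segment_iff seg_edge_def image_iff)
    also have "\<dots> = (if ((v, i), True) \<in> X then {(v, i)} else {}) \<union> (if ((v, j), True) \<in> X then {(v, j)} else {})"
      unfolding v(3) by auto
    finally show ?thesis unfolding cv_def using v(2) by simp
  qed
  have au: "a < length (rot G u)" using Zu by blast
  then have uV: "u \<in> ?V" using rot_outside[OF rg] by (cases "u \<in> verts G") auto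
  \<comment> \<open>The two segments of \<open>Z\<close> at \<open>v\<close> are the only ones of
    \<open>bd G X\<close> there, so the walk past the second changes sides once and just one of the
    two last points is covered.\<close>
  have odd_v: "odd (cv v) \<longleftrightarrow> deg G Z v = 2" if v: "v \<in> ?V" "v \<noteq> u" for v
  proof (cases "deg G Z v = 0")
    case True
    then have "{s \<in> S. fst s = v} = {}"
      by (auto simp: deg_eq_0_iff S_def seg_edge_def segments_def)
    then have "cv v = 0" unfolding cv_def by (simp only: card.empty)
    then show ?thesis using True by simp
  next
    case False
    let ?I = "\<lambda>Y. {k. k < length (rot G v) \<and> fst (rot G v ! k) \<in> Y}"
    have d: "card (?I Z) = 2" "card (?I (bd G X)) = 2" using away[OF v(2)] False by (auto simp: deg_card)
    have same: "?I Z = ?I (bd G X)"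
      by (rule card_subset_eq) (use d Z in auto)
    obtain i j where "?I Z = {i, j}" "i \<noteq> j" using d(1) by (auto simp: card_2_iff)
    then obtain i j where ij: "?I Z = {i, j}" "i < j" by (metis insert_commute linorder_neqE_nat)
    then have jl: "j < length (rot G v)" "fst (rot G v ! j) \<in> bd G X" using same by blast+
    have "((v, i), True) \<in> X \<longleftrightarrow> ((v, j), False) \<in> X"
    proof (rule face_set_walk[OF X ij(2) jl(1)])
      fix k assume "i < k" "k < j"
      then have "k \<notin> ?I (bd G X)" using ij same by auto
      then show "fst (rot G v ! k) \<notin> bd G X" using \<open>k < j\<close> jl(1) by auto
    qed
    moreover have "((v, j), False) \<in> X \<longleftrightarrow> ((v, j), True) \<notin> X"
      using bd_iff[OF X, of "(v, j)"] jl v(1) by (auto simp: segment_iff seg_edge_def)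
    ultimately show ?thesis using cv[OF v(1) _ ij(1)] ij(2) away[OF v(2)] False by auto
  qed
  have odd_u: "odd (cv u) \<longleftrightarrow> (((u, a), True) \<in> X) \<noteq> (((u, c), True) \<in> X)"
    using cv[OF uV _ Zu] u by simp
  let ?W = "{v \<in> ?V. deg G Z v = 2}"
  have du: "deg G Z u = 2" unfolding deg_card Zu using u by simp
  have finW: "finite ?W" using finite_verts[OF rg] by simp
  have "2 * card Z = (\<Sum>v \<in> ?V. deg G Z v)" using handshake[OF rg ZE] by simp
  also have "\<dots> = (\<Sum>v \<in> ?W. deg G Z v)"
  proof (rule sum.mono_neutral_right)
    show "\<forall>i \<in> ?V - ?W. deg G Z i = 0"
    proof
      fix i assume "i \<in> ?V - ?W"
      then show "deg G Z i = 0" using away[of i] du by (cases "i = u") auto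
    qed
  qed (use finite_verts[OF rg] in auto)
  also have "\<dots> = 2 * card ?W" by simp
  finally have cW: "card ?W = card Z" by simp
  have "{v \<in> ?V. odd (cv v)} = (if odd (cv u) then ?W else ?W - {u})"
  proof (rule set_eqI)
    fix v
    show "v \<in> {v \<in> ?V. odd (cv v)} \<longleftrightarrow> v \<in> (if odd (cv u) then ?W else ?W - {u})"
      using odd_v[of v] du uV by (cases "v = u"; cases "v \<in> ?V") simp_all
  qed
  moreover have "card ?W = Suc (card (?W - {u}))"
    by (rule card_Suc_Diff1[symmetric, OF finW]) (use du uV in simp)
  \<comment> \<open>The other \<open>card Z - 1\<close> vertices of \<open>Z\<close> each contribute
    an odd number, and the contribution of \<open>u\<close> decides the rest.\<close>
  ultimately have by_verts: "even (card S) \<longleftrightarrow> (odd (cv u) \<longleftrightarrow> even (card Z))"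
    using v1 cW by auto
  have "card Z = card {e \<in> Z. twisted G e} + card {e \<in> Z. \<not> twisted G e}"
  proof -
    have "Z = {e \<in> Z. twisted G e} \<union> {e \<in> Z. \<not> twisted G e}" by blast
    moreover have "card ({e \<in> Z. twisted G e} \<union> {e \<in> Z. \<not> twisted G e}) =
        card {e \<in> Z. twisted G e} + card {e \<in> Z. \<not> twisted G e}"
      by (rule card_Un_disjoint) (use finZ in auto)
    ultimately show ?thesis by simp
  qed
  then show ?thesis using by_edges by_verts odd_u by auto
qed

end

subsection \<open>Crossing cycles in plane and projective plane ribbon graphs\<close>

lemma subseq_ConsE:
  assumes "subseq (x # xs) ys"
  obtains i where "i < length ys" "ys ! i = x" "subseq xs (drop (Suc i) ys)"
proof -
  obtain us v vs where "ys = us @ v # vs" "x = v" "subseq xs vs"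
    using list_emb_ConsD[OF assms] by blast
  then show thesis using that[of "length us"] by simp
qed

lemma subseq_4_indices:
  assumes "subseq [w, x, y, z] r"
  obtains a b c d where "a < b" "b < c" "c < d" "d < length r"
    "r ! a = w" "r ! b = x" "r ! c = y" "r ! d = z"
proof -
  obtain a where a: "a < length r" "r ! a = w" "subseq [x, y, z] (drop (Suc a) r)"
    using assms by (rule subseq_ConsE)
  obtain b where b: "b < length (drop (Suc a) r)" "drop (Suc a) r ! b = x"
    "subseq [y, z] (drop (Suc b) (drop (Suc a) r))" using a(3) by (rule subseq_ConsE)
  obtain c where c: "c < length (drop (Suc b) (drop (Suc a) r))" "drop (Suc b) (drop (Suc a) r) ! c = y"
    "subseq [z] (drop (Suc c) (drop (Suc b) (drop (Suc a) r)))" using b(3) by (rule subseq_ConsE)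
  obtain d where d: "d < length (drop (Suc c) (drop (Suc b) (drop (Suc a) r)))"
    "drop (Suc c) (drop (Suc b) (drop (Suc a) r)) ! d = z" using c(3) by (rule subseq_ConsE)
  show thesis
    by (rule that[of a "Suc a + b" "Suc a + Suc b + c" "Suc a + Suc b + Suc c + d"])
      (use a b c d in \<open>auto simp: algebra_simps\<close>)
qed

lemma two_positions:
  assumes "deg G Z u = 2" "i \<noteq> j" "i < length (rot G u)" "j < length (rot G u)"
    and "fst (rot G u ! i) \<in> Z" "fst (rot G u ! j) \<in> Z"
  shows "{k. k < length (rot G u) \<and> fst (rot G u ! k) \<in> Z} = {i, j}"
  by (rule card_subset_eq[symmetric]) (use assms in \<open>auto simp: deg_card\<close>)

lemma cycle_at_degree: "cycle_at G u Z \<Longrightarrow> deg G Z v = 0 \<or> deg G Z v = 2"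
  unfolding cycle_at_def by blast

lemma cycle_at_cycle_space:
  assumes "ribbon_graph G" "cycle_at G u Z"
  shows "Z \<in> cycle_space G"
  using cycle_at_even[OF assms(2)] assms(2) by (simp add: cycle_space_def[OF assms(1)] cycle_at_def)

text \<open>Packaged as a locale in order to be interpreted in \<open>G\<close> and again in the
  side component containing both cycles, whose genus is known.\<close>

locale crossing_cycles =
  fixes G :: "('v, 'e) ribbon_graph" and u x1 x2 x3 x4 Z Z'
  assumes rg: "ribbon_graph G"
    and Z: "cycle_at G u Z" and Z': "cycle_at G u Z'"
    and disjoint: "Z \<inter> Z' = {}"
    and apart: "\<And>v. v \<noteq> u \<Longrightarrow> deg G Z v = 0 \<or> deg G Z' v = 0"
    and crossing: "subseq [x1, x2, x3, x4] (rot G u)"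
    and mem: "fst x1 \<in> Z" "fst x3 \<in> Z" "fst x2 \<in> Z'" "fst x4 \<in> Z'"
begin

lemma positions:
  obtains a b c d where "a < b" "b < c" "c < d" "d < length (rot G u)"
    "{k. k < length (rot G u) \<and> fst (rot G u ! k) \<in> Z} = {a, c}"
    "{k. k < length (rot G u) \<and> fst (rot G u ! k) \<in> Z'} = {b, d}"
proof -
  obtain a b c d where p: "a < b" "b < c" "c < d" "d < length (rot G u)"
    "rot G u ! a = x1" "rot G u ! b = x2" "rot G u ! c = x3" "rot G u ! d = x4"
    using crossing by (rule subseq_4_indices)
  have du: "deg G Z u = 2" "deg G Z' u = 2" using Z Z' by (auto simp: cycle_at_def)
  show thesis
    by (rule that[OF p(1-4) two_positions[OF du(1)] two_positions[OF du(2)]]) (use p mem in auto)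
qed

text \<open>If one of the cycles bounded a region, the other would cross that boundary just once at
  \<open>u\<close>: \<open>c\<close> is the only segment of \<open>Z\<close> between
  \<open>b\<close> and \<open>d\<close>, and \<open>b\<close> the only one of \<open>Z'\<close>
  between \<open>a\<close> and \<open>c\<close>.\<close>

lemma not_boundary: "Z \<notin> boundaries G" "Z' \<notin> boundaries G"
proof -
  obtain a b c d where p: "a < b" "b < c" "c < d" "d < length (rot G u)"
    "{k. k < length (rot G u) \<and> fst (rot G u ! k) \<in> Z} = {a, c}"
    "{k. k < length (rot G u) \<and> fst (rot G u ! k) \<in> Z'} = {b, d}" by (rule positions)
  have sub: "Z \<subseteq> edges G" "Z' \<subseteq> edges G" "even_set G Z" "even_set G Z'"
    using cycle_at_even[OF Z] cycle_at_even[OF Z'] Z Z' by (simp_all add: cycle_at_def)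
  show "Z \<notin> boundaries G"
  proof
    assume "Z \<in> boundaries G"
    then obtain X where X: "face_set G X" "Z = bd G X" by (auto simp: boundaries_def[OF rg])
    show False
    proof (rule crossing_not_boundary[OF rg X(1) sub(2,4) _ _ p(2,3,4,6)])
      show "Z' \<inter> bd G X = {}" using disjoint X by blast
      show "deg G (bd G X) v = 0" if "v \<noteq> u" "deg G Z' v > 0" for v
        using apart[OF that(1)] that(2) X(2) by auto
      show "fst (rot G u ! c) \<in> bd G X" using p(5) X(2) by blast
      show "i = c" if "b < i" "i < d" "fst (rot G u ! i) \<in> bd G X" for i
      proof -
        have "i \<in> {k. k < length (rot G u) \<and> fst (rot G u ! k) \<in> Z}" using that p(4) X(2) by auto
        then show ?thesis unfolding p(5) using that p(1) by auto
      qed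
    qed
  qed
  show "Z' \<notin> boundaries G"
  proof
    assume "Z' \<in> boundaries G"
    then obtain X where X: "face_set G X" "Z' = bd G X" by (auto simp: boundaries_def[OF rg])
    have c: "c < length (rot G u)" using p by linarith
    show False
    proof (rule crossing_not_boundary[OF rg X(1) sub(1,3) _ _ p(1,2) c p(5)])
      show "Z \<inter> bd G X = {}" using disjoint X by blast
      show "deg G (bd G X) v = 0" if "v \<noteq> u" "deg G Z v > 0" for v
        using apart[OF that(1)] that(2) X(2) by auto
      show "fst (rot G u ! b) \<in> bd G X" using p(6) X(2) by blast
      show "i = b" if "a < i" "i < c" "fst (rot G u ! i) \<in> bd G X" for i
      proof -
        have "i \<in> {k. k < length (rot G u) \<and> fst (rot G u ! k) \<in> Z'}" using that c X(2) by auto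
        then show ?thesis unfolding p(6) using that p(3) by auto
      qed
    qed
  qed
qed

lemma not_plane: "\<not> plane_rg G"
proof
  assume "plane_rg G"
  moreover have "edges G \<noteq> {}" using Z mem by (auto simp: cycle_at_def)
  ultimately have "cycle_space G = boundaries G" by (rule plane_cycle_space[OF rg])
  then show False using not_boundary(1) cycle_at_cycle_space[OF rg Z] by simp
qed

text \<open>Neither cycle bounds, so their union bounds some \<open>X\<close>. Membership in
  \<open>X\<close> flips at each of the four segments round \<open>u\<close>; hence it agrees at
  \<open>a\<close> and \<open>c\<close>, and at \<open>b\<close> and \<open>d\<close>, which is the
  odd case of \<open>twisted_parity\<close>.\<close>

lemma rp2_twisted:
  assumes "rp2_rg G"
  shows "odd (card {e \<in> Z. twisted G e})" "odd (card {e \<in> Z'. twisted G e})"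
proof -
  obtain a b c d where p: "a < b" "b < c" "c < d" "d < length (rot G u)"
    "{k. k < length (rot G u) \<and> fst (rot G u ! k) \<in> Z} = {a, c}"
    "{k. k < length (rot G u) \<and> fst (rot G u ! k) \<in> Z'} = {b, d}" by (rule positions)
  have "edges G \<noteq> {}" using Z mem by (auto simp: cycle_at_def)
  then have "sym_diff Z Z' \<in> boundaries G"
    using rp2_cycle_space[OF rg assms] not_boundary cycle_at_cycle_space[OF rg] Z Z' by blast
  moreover have "sym_diff Z Z' = Z \<union> Z'" using disjoint by blast
  ultimately obtain X where X: "face_set G X" "bd G X = Z \<union> Z'"
    by (auto simp: boundaries_def[OF rg])
  have uV: "u \<in> verts G" using p(4) rot_outside[OF rg] by (cases "u \<in> verts G") auto
  have dY: "deg G (bd G X) v = deg G Z v + deg G Z' v" for v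
    unfolding X(2) by (rule deg_Un[OF disjoint])
  have pos: "k \<in> {a, b, c, d}" if "k < length (rot G u)" "fst (rot G u ! k) \<in> bd G X" for k
  proof -
    have "k \<in> {k. k < length (rot G u) \<and> fst (rot G u ! k) \<in> Z} \<union>
        {k. k < length (rot G u) \<and> fst (rot G u ! k) \<in> Z'}" using that X(2) by auto
    then show ?thesis unfolding p(5,6) by auto
  qed
  have in_bd: "fst (rot G u ! k) \<in> bd G X" if "k \<in> {a, b, c, d}" for k
    using that p(5,6) X(2) by blast
  have flip: "((u, k), False) \<in> X \<longleftrightarrow> ((u, k), True) \<notin> X" if "k \<in> {a, b, c, d}" for k
    using bd_iff[OF rg X(1), of "(u, k)"] in_bd[OF that] that p uV
    by (auto simp: segment_iff seg_edge_def)
  have alt: "((u, k), True) \<in> X \<longleftrightarrow> ((u, l), True) \<notin> X"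
    if kl: "k < l" "l \<in> {a, b, c, d}" "\<And>m. k < m \<Longrightarrow> m < l \<Longrightarrow> m \<notin> {a, b, c, d}" for k l
  proof -
    have l: "l < length (rot G u)" using kl(2) p by auto
    have "((u, k), True) \<in> X \<longleftrightarrow> ((u, l), False) \<in> X"
      by (rule face_set_walk[OF rg X(1) kl(1) l]) (use pos kl(3) l in \<open>meson less_trans\<close>)
    then show ?thesis using flip[OF kl(2)] by simp
  qed
  have ab: "((u, a), True) \<in> X \<longleftrightarrow> ((u, b), True) \<notin> X" by (rule alt) (use p in auto)
  have bc: "((u, b), True) \<in> X \<longleftrightarrow> ((u, c), True) \<notin> X" by (rule alt) (use p in auto)
  have cd: "((u, c), True) \<in> X \<longleftrightarrow> ((u, d), True) \<notin> X" by (rule alt) (use p in auto)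
  have Z2: "deg G Z v = 0 \<or> deg G Z v = 2 \<and> deg G (bd G X) v = 2" if "v \<noteq> u" for v
    using apart[OF that] cycle_at_degree[OF Z, of v] dY[of v] by auto
  have Z'2: "deg G Z' v = 0 \<or> deg G Z' v = 2 \<and> deg G (bd G X) v = 2" if "v \<noteq> u" for v
    using apart[OF that] cycle_at_degree[OF Z', of v] dY[of v] by auto
  have "a < c" "b < d" using p by auto
  then show "odd (card {e \<in> Z. twisted G e})" "odd (card {e \<in> Z'. twisted G e})"
    using twisted_parity[OF rg X(1) _ _ p(5) Z2] twisted_parity[OF rg X(1) _ _ p(6) Z'2] X(2) ab bc cd by auto
qed

end

text \<open>Here \<open>Z\<close> alone bounds a region, so membership differs after its two
  segments at \<open>u\<close>, which is the even case of \<open>twisted_parity\<close>.\<close>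

lemma plane_cycle_twisted:
  assumes rg: "ribbon_graph G" and pl: "plane_rg G" and Z: "cycle_at G u Z"
  shows "even (card {e \<in> Z. twisted G e})"
proof -
  have d: "deg G Z u = 2" "Z \<subseteq> edges G" using Z by (auto simp: cycle_at_def)
  then have "Z \<noteq> {}" by auto
  then have "Z \<in> boundaries G"
    using plane_cycle_space[OF rg pl] cycle_at_cycle_space[OF rg Z] d by auto
  then obtain X where X: "face_set G X" "Z = bd G X" by (auto simp: boundaries_def[OF rg])
  let ?I = "{k. k < length (rot G u) \<and> fst (rot G u ! k) \<in> Z}"
  have "card ?I = 2" using d by (simp add: deg_card)
  then obtain i j where "?I = {i, j}" "i \<noteq> j" by (auto simp: card_2_iff)
  then obtain a c where ac: "?I = {a, c}" "a < c" by (metis insert_commute linorder_neqE_nat)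
  then have cl: "c < length (rot G u)" "fst (rot G u ! c) \<in> bd G X" using X by blast+
  then have uV: "u \<in> verts G" using rot_outside[OF rg] by (cases "u \<in> verts G") auto
  have "((u, a), True) \<in> X \<longleftrightarrow> ((u, c), False) \<in> X"
  proof (rule face_set_walk[OF rg X(1) ac(2) cl(1)])
    fix k assume "a < k" "k < c"
    then have "k \<notin> ?I" using ac by auto
    then show "fst (rot G u ! k) \<notin> bd G X" using \<open>k < c\<close> cl(1) X(2) by auto
  qed
  moreover have "((u, c), False) \<in> X \<longleftrightarrow> ((u, c), True) \<notin> X"
    using bd_iff[OF rg X(1), of "(u, c)"] cl uV by (auto simp: segment_iff seg_edge_def)
  moreover have "deg G Z v = 0 \<or> deg G Z v = 2 \<and> deg G (bd G X) v = 2" for v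
    using cycle_at_degree[OF Z, of v] X(2) by auto
  ultimately show ?thesis using twisted_parity[OF rg X(1) _ ac(2,1)] X(2) by auto
qed

subsection \<open>Components of the two sides of a biseparation\<close>

text \<open>All vertices are kept, so one definition serves both sides at every vertex.
  \<open>side_component_separated\<close> identifies it with a component of
  \<open>edge_restriction G A\<close> when an edge of \<open>A\<close> meets
  \<open>u\<close>.\<close>

definition side_component :: "('v, 'e) ribbon_graph \<Rightarrow> 'e set \<Rightarrow> 'v \<Rightarrow> ('v, 'e) ribbon_graph" where
  "side_component G F u = component_of (restrict G (verts G) F) u"

lemma side_component_props:
  assumes rg: "ribbon_graph G" and F: "F \<subseteq> edges G" and u: "u \<in> verts G"
  shows "ribbon_subgraph (side_component G F u) G" "edges (side_component G F u) \<subseteq> F"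
    "u \<in> verts (side_component G F u)"
    "\<And>e w. e \<in> F \<Longrightarrow> w \<in> verts (side_component G F u) \<Longrightarrow> incident G e w \<Longrightarrow>
       e \<in> edges (side_component G F u)"
proof -
  let ?R = "restrict G (verts G) F" and ?H = "side_component G F u"
  define W where "W = {w \<in> verts G. (u, w) \<in> (adjacency ?R)\<^sup>*}"
  define D where "D = {e \<in> F. \<exists>w \<in> W. incident G e w}"
  have inc: "incident ?R e w \<longleftrightarrow> e \<in> F \<and> incident G e w" for e w
    using incident_restrict[OF rg, of "verts G" F] by (auto simp: incident_iff)
  have D': "{e \<in> F. \<exists>w \<in> W. incident ?R e w} = D" by (auto simp: D_def inc)
  have HR: "?H = restrict ?R W D"
    unfolding side_component_def component_of_def Let_def
    by (simp add: restrict_def W_def[unfolded restrict_def] D'[unfolded restrict_def, symmetric])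
  have WD: "W \<subseteq> verts G" "D \<subseteq> F" "D \<subseteq> edges G" using F by (auto simp: W_def D_def)
  have H: "?H = restrict G W D"
    unfolding HR using WD by (auto simp: restrict_def fun_eq_iff intro!: filter_cong)
  have cl: "v \<in> W" if "e \<in> D" "incident G e v" for e v
  proof -
    obtain w where "w \<in> W" "incident G e w" "e \<in> F" using \<open>e \<in> D\<close> by (auto simp: D_def)
    moreover have "edges ?R = F" by (simp add: restrict_def)
    ultimately have "(w, v) \<in> adjacency ?R" using that(2) unfolding adjacency_def inc by blast
    then show ?thesis using \<open>w \<in> W\<close> that(2) rtrancl_into_rtrancl by (fastforce simp: W_def incident_iff)
  qed
  have "ribbon_graph ?H" unfolding H by (rule ribbon_graph_restrict[OF rg WD(1,3) cl])
  then show "ribbon_subgraph ?H G"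
    using WD unfolding ribbon_subgraph_def H by (simp add: restrict_def)
  show "edges ?H \<subseteq> F" unfolding H using WD by (simp add: restrict_def)
  show "u \<in> verts ?H" unfolding H using u by (simp add: restrict_def W_def)
  show "e \<in> edges ?H" if "e \<in> F" "w \<in> verts ?H" "incident G e w" for e w
    using that unfolding H by (auto simp: restrict_def D_def)
qed

text \<open>No edge of \<open>F\<close> leaves the component, so its part of \<open>Z\<close> is
  even; it is nonempty at \<open>u\<close>, and the minimality of a cycle makes it all of
  \<open>Z\<close>.\<close>

lemma cycle_in_side_component:
  assumes rg: "ribbon_graph G" and F: "F \<subseteq> edges G" and Z: "cycle_at G u Z" "Z \<subseteq> F"
  shows "Z \<subseteq> edges (side_component G F u)" "cycle_at (side_component G F u) u Z"
proof -
  let ?H = "side_component G F u"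
  have d: "deg G Z u = 2" using Z by (simp add: cycle_at_def)
  have u: "u \<in> verts G" using d deg_outside[OF rg, of u Z] by (cases "u \<in> verts G") auto
  note H = side_component_props[OF rg F u]
  have at: "e \<in> edges ?H" if "e \<in> F" "w \<in> verts ?H" "(e, b) \<in> set (rot G w)" for e w b
    using H(4)[OF that(1,2)] that(3) by (force simp: incident_rot[OF rg])
  have "even (deg G (Z \<inter> edges ?H) v)" for v
  proof (cases "v \<in> verts ?H")
    case True
    have "filter (\<lambda>x. fst x \<in> Z \<inter> edges ?H) (rot G v) = filter (\<lambda>x. fst x \<in> Z) (rot G v)"
      using at[OF _ True] Z(2) by (intro filter_cong) auto
    then show ?thesis using cycle_at_even[OF Z(1)] by (simp add: deg_def even_set_def)
  next
    case False
    have "deg G (Z \<inter> edges ?H) v = deg ?H (Z \<inter> edges ?H) v"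
      using deg_subgraph[OF rg H(1)] by simp
    also have "\<dots> = 0" using H(1) deg_outside[OF _ False] by (simp add: ribbon_subgraph_def)
    finally show ?thesis by simp
  qed
  then have ev: "even_set G (Z \<inter> edges ?H)" by (simp add: even_set_def)
  have "\<exists>x \<in> set (rot G u). fst x \<in> Z" using d deg_eq_0_iff[of G Z u] by auto
  then obtain e b where "(e, b) \<in> set (rot G u)" "e \<in> Z" by auto
  then have "e \<in> Z \<inter> edges ?H" using at[OF _ H(3)] Z(2) by blast
  then have "Z \<inter> edges ?H = Z" using Z(1) ev unfolding cycle_at_def by blast
  then show sub: "Z \<subseteq> edges ?H" by blast
  have "deg ?H Y v = deg G Y v" if "Y \<subseteq> Z" for Y v
    using deg_subgraph[OF rg H(1)] that sub by (meson order_trans)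
  then show "cycle_at ?H u Z" using Z(1) sub unfolding cycle_at_def even_set_def by auto
qed

lemma twisted_subgraph:
  assumes rg: "ribbon_graph G" and H: "ribbon_subgraph H G" and e: "e \<in> edges H"
  shows "twisted H e \<longleftrightarrow> twisted G e"
proof -
  have rotH: "rot H v = (if v \<in> verts H then filter (\<lambda>x. fst x \<in> edges H) (rot G v) else [])" for v
  proof -
    have "H = restrict G (verts H) (edges H)" using H by (simp add: ribbon_subgraph_def)
    then have "rot H v = rot (restrict G (verts H) (edges H)) v" by (rule arg_cong)
    then show ?thesis by (simp add: restrict_def)
  qed
  have "(e, b) \<in> set (rot H v) \<longleftrightarrow> (e, b) \<in> set (rot G v)" for v b
  proof
    assume "(e, b) \<in> set (rot G v)"
    then have "incident G e v" by (force simp: incident_rot[OF rg])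
    then have "v \<in> verts H" using subgraph_incident[OF rg H e] by (simp add: incident_iff)
    then show "(e, b) \<in> set (rot H v)" using \<open>(e, b) \<in> set (rot G v)\<close> e by (simp add: rotH)
  qed (auto simp: rotH split: if_splits)
  then show ?thesis by (simp add: twisted_def)
qed

lemma side_component_separated:
  assumes rg: "ribbon_graph G" and A: "A \<subseteq> edges G" and u: "u \<in> verts G"
  shows "side_component G (edges G - A) u \<in> separated_components G A"
    "(\<exists>e \<in> A. incident G e u) \<Longrightarrow> side_component G A u \<in> separated_components G A"
proof -
  show "side_component G (edges G - A) u \<in> separated_components G A"
    unfolding separated_components_def side_component_def components_rg_def delete_edges_def
    using u by (auto simp: restrict_def)
  assume ex: "\<exists>e \<in> A. incident G e u"
  define U where "U = {v \<in> verts G. \<exists>e \<in> A. incident G e v}"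
  let ?R = "restrict G (verts G) A" and ?R' = "restrict G U A"
  have UV: "U \<subseteq> verts G" by (auto simp: U_def)
  have inc: "incident ?R e w \<longleftrightarrow> incident ?R' e w" for e w
    using incident_restrict[OF rg order_refl, of A e w] incident_restrict[OF rg UV, of A e w]
    by (auto simp: U_def)
  have adj: "adjacency ?R = adjacency ?R'" unfolding adjacency_def inc by (simp add: restrict_def)
  have uU: "u \<in> U" using ex u by (auto simp: U_def)
  have "w \<in> U" if "(u, w) \<in> (adjacency ?R')\<^sup>*" for w
    using that
  proof (induction rule: rtrancl_induct)
    case (step y z)
    then show ?case by (auto simp: adjacency_def incident_iff restrict_def)
  qed (rule uU)
  then have W: "{w \<in> verts ?R. (u, w) \<in> (adjacency ?R)\<^sup>*} = {w \<in> verts ?R'. (u, w) \<in> (adjacency ?R')\<^sup>*}"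
    unfolding adj using UV by (auto simp: restrict_def)
  have "component_of ?R u = component_of ?R' u"
  proof -
    let ?W = "{w \<in> verts ?R'. (u, w) \<in> (adjacency ?R')\<^sup>*}"
    have "?W \<subseteq> U" by (auto simp: restrict_def)
    have "restrict ?R ?W D = restrict ?R' ?W D" for D
      using \<open>?W \<subseteq> U\<close> UV by (auto simp: restrict_def fun_eq_iff)
    then show ?thesis unfolding component_of_def Let_def W inc by (simp add: restrict_def)
  qed
  then show "side_component G A u \<in> separated_components G A"
    using uU unfolding separated_components_def side_component_def components_rg_def edge_restriction_def
    by (auto simp: U_def[symmetric] restrict_def)
qed

lemma separated_components_edges:
  "H \<in> separated_components G A \<Longrightarrow> edges H \<subseteq> A \<or> edges H \<subseteq> edges G - A"
  by (auto simp: separated_components_def components_rg_def component_of_def edge_restriction_def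
      delete_edges_def restrict_def Let_def)

text \<open>\<open>A\<close> is the side that contains the projective plane component, if there is one.\<close>

definition good_side :: "('v, 'e) ribbon_graph \<Rightarrow> 'e set \<Rightarrow> bool" where
  "good_side G A \<longleftrightarrow> A \<subseteq> edges G \<and>
     (\<forall>u Z. cycle_at G u Z \<longrightarrow>
        Z \<subseteq> A \<and> (plane_rg (side_component G A u) \<or> rp2_rg (side_component G A u)) \<or>
        Z \<subseteq> edges G - A \<and> plane_rg (side_component G (edges G - A) u))"

lemma cycle_side_separated:
  assumes rg: "ribbon_graph G" and A: "A \<subseteq> edges G" and F: "F = A \<or> F = edges G - A"
    and Z: "cycle_at G u Z" "Z \<subseteq> F"
  shows "side_component G F u \<in> separated_components G A"
    "edges (side_component G F u) \<inter> F \<noteq> {}"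
proof -
  have d: "deg G Z u = 2" using Z by (simp add: cycle_at_def)
  have u: "u \<in> verts G" using d deg_outside[OF rg, of u Z] by (cases "u \<in> verts G") auto
  have "\<exists>x \<in> set (rot G u). fst x \<in> Z" using d deg_eq_0_iff[of G Z u] by auto
  then have "\<exists>e \<in> Z. incident G e u" by (auto simp: incident_rot[OF rg])
  then have "\<exists>e \<in> F. incident G e u" using Z by blast
  then show "side_component G F u \<in> separated_components G A"
    using side_component_separated[OF rg A u] F by blast
  have "F \<subseteq> edges G" using F A by blast
  then have "Z \<subseteq> edges (side_component G F u)" by (rule cycle_in_side_component[OF rg _ Z])
  moreover have "Z \<noteq> {}" using d by auto
  ultimately show "edges (side_component G F u) \<inter> F \<noteq> {}" using Z by blast
qed

text \<open>\<open>H0\<close> is the exceptional component, or an arbitrary one if all are plane.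
  Choose the side \<open>F\<close> containing its edges; a cycle on the other side lies in a
  component with an edge outside \<open>F\<close>, which is therefore not \<open>H0\<close>.\<close>

lemma good_side_exists:
  assumes rg: "ribbon_graph G" and b: "biseparation G A"
    and H0: "\<forall>H \<in> separated_components G A. H \<noteq> H0 \<longrightarrow> plane_rg H"
      "H0 \<in> separated_components G A" "plane_rg H0 \<or> rp2_rg H0"
  shows "good_side G A \<or> good_side G (edges G - A)"
proof -
  have A: "A \<subseteq> edges G" using b by (simp add: biseparation_def)
  have "good_side G F" if F: "edges H0 \<subseteq> F" "F = A \<or> F = edges G - A" for F
    unfolding good_side_def
  proof (intro conjI allI impI)
    show FE: "F \<subseteq> edges G" using F A by blast
    have F': "edges G - F = A \<or> edges G - F = edges G - A" using F A by blast
    fix u Z assume Z: "cycle_at G u Z"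
    have "Z \<subseteq> F \<or> Z \<subseteq> edges G - F" using biseparation_cycle[OF rg b Z] F A by blast
    then show "Z \<subseteq> F \<and> (plane_rg (side_component G F u) \<or> rp2_rg (side_component G F u)) \<or>
        Z \<subseteq> edges G - F \<and> plane_rg (side_component G (edges G - F) u)"
    proof
      assume "Z \<subseteq> F"
      then show ?thesis using cycle_side_separated[OF rg A F(2) Z] H0 by metis
    next
      assume "Z \<subseteq> edges G - F"
      note s = cycle_side_separated[OF rg A F' Z this]
      then have "side_component G (edges G - F) u \<noteq> H0" using F(1) by blast
      then show ?thesis using s(1) H0(1) \<open>Z \<subseteq> edges G - F\<close> by blast
    qed
  qed
  then show ?thesis using separated_components_edges[OF H0(2)] by blast
qed

text \<open>Unseparated by \<open>A\<close>, both cycles lie in one side component at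
  \<open>u\<close>. A crossing excludes a plane component, so it is a projective plane one, and such
  a component through a cycle occurs only on the side \<open>A\<close>.\<close>

lemma good_side_crossing_one_sided:
  assumes rg: "ribbon_graph G" and g: "good_side G A"
    and cc: "crossing_cycles G u x1 x2 x3 x4 Z Z'"
    and same: "fst x1 \<in> A \<longleftrightarrow> fst x2 \<in> A"
  shows "Z \<subseteq> A \<and> Z' \<subseteq> A \<and> odd (card {e \<in> Z. twisted G e}) \<and> odd (card {e \<in> Z'. twisted G e})"
proof -
  interpret crossing_cycles G u x1 x2 x3 x4 Z Z' by (rule cc)
  have A: "A \<subseteq> edges G" using g by (simp add: good_side_def)
  have "(Z \<subseteq> A \<and> Z' \<subseteq> A) \<or> (Z \<subseteq> edges G - A \<and> Z' \<subseteq> edges G - A)"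
    using g Z Z' mem same unfolding good_side_def by blast
  then obtain F where F: "F \<subseteq> edges G" "Z \<subseteq> F" "Z' \<subseteq> F" "F = A \<or> F = edges G - A" using A by blast
  let ?H = "side_component G F u"
  have u: "u \<in> verts G" using crossing rot_outside[OF rg] by (cases "u \<in> verts G") auto
  note H = side_component_props[OF rg F(1) u]
  note cyc = cycle_in_side_component[OF rg F(1) Z F(2)] cycle_in_side_component[OF rg F(1) Z' F(3)]
  have dH: "deg ?H Y v = deg G Y v" if "Y \<subseteq> edges ?H" for Y v by (rule deg_subgraph[OF rg H(1) that])
  have "crossing_cycles ?H u x1 x2 x3 x4 Z Z'"
  proof
    show "ribbon_graph ?H" using H(1) by (simp add: ribbon_subgraph_def)
    show "deg ?H Z v = 0 \<or> deg ?H Z' v = 0" if "v \<noteq> u" for v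
      using apart[OF that] dH cyc by simp
    have eq: "rot ?H u = filter (\<lambda>x. fst x \<in> edges ?H) (rot G u)"
    proof -
      have "?H = restrict G (verts ?H) (edges ?H)" using H(1) by (simp add: ribbon_subgraph_def)
      then have "rot ?H u = rot (restrict G (verts ?H) (edges ?H)) u" by (rule arg_cong)
      then show ?thesis using H(3) by (simp add: restrict_def)
    qed
    have "filter (\<lambda>x. fst x \<in> edges ?H) [x1, x2, x3, x4] = [x1, x2, x3, x4]" using mem cyc by auto
    then show "subseq [x1, x2, x3, x4] (rot ?H u)"
      unfolding eq using subseq_filter[OF crossing] by metis
  qed (use cyc disjoint mem in auto)
  then interpret H: crossing_cycles ?H u x1 x2 x3 x4 Z Z' .
  have "\<not> (Z \<subseteq> edges G - A \<and> F = A) \<and> \<not> (Z \<subseteq> A \<and> F = edges G - A)" using F mem by blast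
  then have FA: "F = A" "rp2_rg ?H"
    using g Z H.not_plane F unfolding good_side_def by metis+
  have "{e \<in> Y. twisted ?H e} = {e \<in> Y. twisted G e}" if "Y \<subseteq> edges ?H" for Y
    using that twisted_subgraph[OF rg H(1)] by blast
  then show ?thesis using H.rp2_twisted[OF FA(2)] cyc FA F by simp
qed

lemma good_side_one_sided_cycle:
  assumes rg: "ribbon_graph G" and g: "good_side G A" and Z: "cycle_at G u Z"
    and odd: "odd (card {e \<in> Z. twisted G e})"
  shows "Z \<subseteq> A"
proof (rule ccontr)
  let ?H = "side_component G (edges G - A) u"
  assume "\<not> Z \<subseteq> A"
  then have s: "Z \<subseteq> edges G - A" "plane_rg ?H" using g Z unfolding good_side_def by blast+
  have u: "u \<in> verts G" using Z deg_outside[OF rg, of u Z] by (cases "u \<in> verts G") (auto simp: cycle_at_def)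
  have sub: "edges G - A \<subseteq> edges G" by blast
  note H = side_component_props[OF rg sub u]
  note cyc = cycle_in_side_component[OF rg sub Z s(1)]
  have rH: "ribbon_graph ?H" using H(1) by (simp add: ribbon_subgraph_def)
  have "{e \<in> Z. twisted ?H e} = {e \<in> Z. twisted G e}"
    using cyc(1) twisted_subgraph[OF rg H(1)] by blast
  then show False using plane_cycle_twisted[OF rH s(2) cyc(2)] odd by simp
qed

section \<open>Comparison of the two biseparations\<close>

text \<open>Related edges lie on a common cycle and so on one side. For interlaced pairs in
  different bridges, \<open>sym_diff A B\<close> could tell the pairs apart only if exactly one of
  \<open>A\<close>, \<open>B\<close> separated them; but as soon as one fails to separate them, both
  cycles are one-sided and lie in both sets.\<close>

lemma good_sides_noncrossing:
  assumes rg: "ribbon_graph G" and A: "good_side G A" and B: "good_side G B"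
  shows "noncrossing_set G (sym_diff A B)"
proof -
  have mono: "fst x \<in> F \<longleftrightarrow> fst y \<in> F"
    if F: "good_side G F" and xy: "x \<in> set (rot G u)" "y \<in> set (rot G u)" "(fst x, fst y) \<in> (off G u)\<^sup>*" for F x y u
  proof (cases "x = y")
    case False
    have "\<exists>Z u. cycle_at G u Z \<and> fst x \<in> Z \<and> fst y \<in> Z"
    proof -
      obtain i j where ij: "i < length (rot G u)" "j < length (rot G u)" "rot G u ! i = x" "rot G u ! j = y"
        using xy by (auto simp: in_set_conv_nth)
      have 2: "subseq [r ! k, r ! l] r" if "k < l" "l < length r" for r :: "('b \<times> bool) list" and k l
        using subseq_nth_Cons_drop[of 0 k r "[r ! l]"] subseq_nth_Cons_drop[of "Suc k" l r "[]"] that by simp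
      have "i \<noteq> j" using ij False by auto
      then consider "subseq [x, y] (rot G u)" | "subseq [y, x] (rot G u)"
        using 2 ij by (metis linorder_neqE_nat)
      then show ?thesis
        using cycle_at_exists[OF rg] xy(3) sym_off[OF rg xy(3)] by cases blast+
    qed
    then show ?thesis using F unfolding good_side_def by blast
  qed simp
  show ?thesis unfolding noncrossing_set_def
  proof (intro conjI allI ballI impI)
    fix u x y assume "x \<in> set (rot G u)" "y \<in> set (rot G u)" "(fst x, fst y) \<in> (off G u)\<^sup>*"
    then show "fst x \<in> sym_diff A B \<longleftrightarrow> fst y \<in> sym_diff A B" using mono[OF A] mono[OF B] by blast
  next
    fix u x1 x2 x3 x4 assume cr: "subseq [x1, x2, x3, x4] (rot G u)"
      and o13: "(fst x1, fst x3) \<in> (off G u)\<^sup>*" and o24: "(fst x2, fst x4) \<in> (off G u)\<^sup>*"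
    have mem: "x \<in> set (rot G u)" if "x \<in> set [x1, x2, x3, x4]" for x
      using list_emb_set[OF cr that] by metis
    show "fst x1 \<in> sym_diff A B \<longleftrightarrow> fst x2 \<in> sym_diff A B"
    proof (cases "(fst x1, fst x2) \<in> (off G u)\<^sup>*")
      case True
      then show ?thesis using mono[OF A _ _ True] mono[OF B _ _ True] mem[of x1] mem[of x2] by auto
    next
      case False
      have "subseq [x1, x3] [x1, x2, x3, x4]" "subseq [x2, x4] [x1, x2, x3, x4]" by auto
      then have "subseq [x1, x3] (rot G u)" "subseq [x2, x4] (rot G u)"
        using cr subseq_order.trans by blast+
      then obtain Z Z' where Z: "cycle_at G u Z" "fst x1 \<in> Z" "fst x3 \<in> Z" "Z \<subseteq> {f. (fst x1, f) \<in> (off G u)\<^sup>*}"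
        and Z': "cycle_at G u Z'" "fst x2 \<in> Z'" "fst x4 \<in> Z'" "Z' \<subseteq> {f. (fst x2, f) \<in> (off G u)\<^sup>*}"
        using cycle_at_exists[OF rg _ o13] cycle_at_exists[OF rg _ o24] by metis
      have sep: "(f, g) \<notin> (off G u)\<^sup>*" if "f \<in> Z" "g \<in> Z'" for f g
      proof
        assume "(f, g) \<in> (off G u)\<^sup>*"
        moreover have "(fst x1, f) \<in> (off G u)\<^sup>*" "(g, fst x2) \<in> (off G u)\<^sup>*"
          using that Z(4) Z'(4) sym_off[OF rg] by blast+
        ultimately show False using False by (meson rtrancl_trans)
      qed
      have cc: "crossing_cycles G u x1 x2 x3 x4 Z Z'"
      proof
        show "Z \<inter> Z' = {}" using sep by blast
        show "deg G Z v = 0 \<or> deg G Z' v = 0" if v: "v \<noteq> u" for v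
        proof (rule ccontr)
          assume "\<not> ?thesis"
          then obtain y z where "y \<in> set (rot G v)" "fst y \<in> Z" "z \<in> set (rot G v)" "fst z \<in> Z'"
            unfolding deg_eq_0_iff by blast
          then have "(fst y, fst z) \<in> off G u" using v by (auto simp: off_def incident_rot[OF rg])
          then show False using sep \<open>fst y \<in> Z\<close> \<open>fst z \<in> Z'\<close> by blast
        qed
      qed (use rg Z Z' cr in auto)
      have both: "fst x1 \<in> F' \<and> fst x2 \<in> F'"
        if F: "good_side G F" "good_side G F'" "fst x1 \<in> F \<longleftrightarrow> fst x2 \<in> F" for F F'
        using good_side_crossing_one_sided[OF rg F(1) cc F(3)]
          good_side_one_sided_cycle[OF rg F(2) Z(1)] good_side_one_sided_cycle[OF rg F(2) Z'(1)] Z(2) Z'(2) by blast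
      show ?thesis using both[OF A A] both[OF A B] both[OF B A] both[OF B B] by blast
    qed
  qed
qed

lemma toggle_complement:
  assumes "A \<subseteq> edges G"
  shows "toggle_related G A (edges G - A)"
proof -
  have "edges G - A = sym_diff A (edges G)" using assms by blast
  then have "toggle_step G A (edges G - A)"
    unfolding toggle_step_def using assms join_seq.single[of G] by (metis list.set_intros(1))
  then show ?thesis by (simp add: toggle_related_def)
qed

theorem theorem3:
  fixes G :: "('v, 'e) ribbon_graph" and A B :: "'e set"
  assumes "ribbon_graph G" and "connected_rg G"
    and "A \<subseteq> edges G" and "B \<subseteq> edges G"
    and "(plane_biseparation G A \<and> plane_biseparation G B) \<or>
         (rp2_biseparation G A \<and> rp2_biseparation G B)"
  shows "toggle_related G A B"
proof -
  have good: "\<exists>F. good_side G F \<and> (F = A \<or> F = edges G - A)"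
    if "plane_biseparation G A \<or> rp2_biseparation G A" for A
  proof -
    have b: "biseparation G A" using that by (auto simp: plane_biseparation_def rp2_biseparation_def)
    then have A: "A \<subseteq> edges G" by (simp add: biseparation_def)
    obtain v where v: "v \<in> verts G" using assms(2) by (auto simp: connected_rg_def)
    have "\<exists>H0 \<in> separated_components G A. (plane_rg H0 \<or> rp2_rg H0) \<and>
        (\<forall>H \<in> separated_components G A. H \<noteq> H0 \<longrightarrow> plane_rg H)"
      using that
    proof
      assume p: "plane_biseparation G A"
      \<comment> \<open>In the plane case any component may serve as \<open>H0\<close>; the one of
        \<open>delete_edges G A\<close> at \<open>v\<close> shows that there is one.\<close>
      then show ?thesis using side_component_separated(1)[OF assms(1) A v]
        unfolding plane_biseparation_def by blast
    next
      assume "rp2_biseparation G A"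
      then show ?thesis unfolding rp2_biseparation_def by blast
    qed
    then show ?thesis using good_side_exists[OF assms(1) b] by blast
  qed
  obtain A' where A': "good_side G A'" "A' = A \<or> A' = edges G - A" using good assms(5) by blast
  obtain B' where B': "good_side G B'" "B' = B \<or> B' = edges G - B" using good assms(5) by blast
  have sub: "A' \<subseteq> edges G" "B' \<subseteq> edges G" using A' B' by (auto simp: good_side_def)
  have "toggle_related G A' (sym_diff A' (sym_diff A' B'))"
    by (rule toggle_related_sym_diff[OF assms(1,2) good_sides_noncrossing[OF assms(1) A'(1) B'(1)]])
      (use sub in auto)
  moreover have "sym_diff A' (sym_diff A' B') = B'" by blast
  ultimately have "toggle_related G A' B'" by simp
  moreover have "toggle_related G A A'"
    using A'(2) toggle_complement[OF assms(3)] by (auto simp: toggle_related_def)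
  moreover have "toggle_related G B' B"
  proof (cases "B' = B")
    case False
    then have "edges G - B' = B" using B'(2) assms(4) by blast
    then show ?thesis using toggle_complement[OF sub(2)] by simp
  qed (simp add: toggle_related_def)
  ultimately show ?thesis unfolding toggle_related_def by (meson rtranclp_trans)
qed

end
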